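(* Let $H$ be a bialgebra over a field $\mathbb{K}$ and $C$ a right $H$-comodule coalgebra. Then every finite subset $F$ of $C$ is contained in a finite dimensional subcomodule subcoalgebra $D$ of $C$ (i.e. $D$ is both an $H$-subcomodule and a subcoalgebra of $C$).
   Context: A right $H$-comodule coalgebra is a coassociative counital coalgebra in the monoidal category $\mathcal{M}^H$ of right $H$-comodules (tensor product $\otimes_{\mathbb{K}}$ with coaction $v\otimes w\mapsto v_0\otimes w_0\otimes v_1w_1$, unit object $\mathbb{K}$ with coaction via the unit of $H$); that is, a $\mathbb{K}$-coalgebra with a right $H$-comodule structure whose comultiplication and counit are $H$-comodule maps. *)

theory Defs
  imports "HOL-Algebra.Module" "HOL-Algebra.AbelCoset"
begin

text \<open>Vector spaces over a field \<open>K\<close> are HOL-Algebra modules over \<open>K\<close>.  The multiplicative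
  part of a \<^type>\<open>module_ext\<close> record is only used where the space also carries an algebra structure.\<close>

section \<open>Linear algebra\<close>

definition lin_map ::
  "('k, 'r) ring_scheme \<Rightarrow> ('k, 'a, 'm) module_scheme \<Rightarrow> ('k, 'b, 'n) module_scheme \<Rightarrow> ('a \<Rightarrow> 'b) \<Rightarrow> bool"
  where "lin_map K V W f \<longleftrightarrow>
    f \<in> carrier V \<rightarrow> carrier W \<and>
    (\<forall>x \<in> carrier V. \<forall>y \<in> carrier V. f (x \<oplus>\<^bsub>V\<^esub> y) = f x \<oplus>\<^bsub>W\<^esub> f y) \<and>
    (\<forall>a \<in> carrier K. \<forall>x \<in> carrier V. f (a \<odot>\<^bsub>V\<^esub> x) = a \<odot>\<^bsub>W\<^esub> f x)"

definition lin_span :: "('k, 'r) ring_scheme \<Rightarrow> ('k, 'a, 'm) module_scheme \<Rightarrow> 'a set \<Rightarrow> 'a set"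
  where "lin_span K V S = \<Inter> {N. submodule N K V \<and> S \<subseteq> N}"

definition finite_dim_subspace :: "('k, 'r) ring_scheme \<Rightarrow> ('k, 'a, 'm) module_scheme \<Rightarrow> 'a set \<Rightarrow> bool"
  where "finite_dim_subspace K V D \<longleftrightarrow>
    submodule D K V \<and> (\<exists>S. finite S \<and> S \<subseteq> carrier V \<and> D = lin_span K V S)"

definition ground_space :: "('k, 'r) ring_scheme \<Rightarrow> ('k, 'k) module"
  where "ground_space K =
    \<lparr>carrier = carrier K, mult = mult K, one = one K, zero = zero K, add = add K, smult = mult K\<rparr>"

definition quot_space ::
  "('k, 'r) ring_scheme \<Rightarrow> ('k, 'a, 'm) module_scheme \<Rightarrow> 'a set \<Rightarrow> ('k, 'a set) module"
  where "quot_space K V N =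
    \<lparr>carrier = a_rcosets\<^bsub>V\<^esub> N, mult = undefined, one = undefined,
     zero = N, add = (<+>\<^bsub>V\<^esub>),
     smult = (\<lambda>a X. \<Union>x \<in> X. N +>\<^bsub>V\<^esub> (a \<odot>\<^bsub>V\<^esub> x))\<rparr>"

definition free_space :: "('k, 'r) ring_scheme \<Rightarrow> 'x set \<Rightarrow> ('k, 'x \<Rightarrow> 'k) module"
  where "free_space K S =
    \<lparr>carrier = {f. (\<forall>x \<in> S. f x \<in> carrier K) \<and> (\<forall>x. x \<notin> S \<longrightarrow> f x = \<zero>\<^bsub>K\<^esub>) \<and> finite {x. f x \<noteq> \<zero>\<^bsub>K\<^esub>}},
     mult = undefined, one = undefined,
     zero = (\<lambda>x. \<zero>\<^bsub>K\<^esub>), add = (\<lambda>f g x. f x \<oplus>\<^bsub>K\<^esub> g x), smult = (\<lambda>a f x. a \<otimes>\<^bsub>K\<^esub> f x)\<rparr>"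

definition free_gen :: "('k, 'r) ring_scheme \<Rightarrow> 'x \<Rightarrow> 'x \<Rightarrow> 'k"
  where "free_gen K p = (\<lambda>q. if q = p then \<one>\<^bsub>K\<^esub> else \<zero>\<^bsub>K\<^esub>)"


section \<open>Tensor products\<close>

text \<open>\<open>V \<otimes> W\<close> is the free vector space on the set \<open>V \<times> W\<close> modulo the bilinearity relations.\<close>

definition tensor_rels ::
  "('k, 'r) ring_scheme \<Rightarrow> ('k, 'a, 'm) module_scheme \<Rightarrow> ('k, 'b, 'n) module_scheme \<Rightarrow> ('a \<times> 'b \<Rightarrow> 'k) set"
  where "tensor_rels K V W =
   (let F = free_space K (carrier V \<times> carrier W); e = (\<lambda>v w. free_gen K (v, w)) in
     {e (v \<oplus>\<^bsub>V\<^esub> v') w \<ominus>\<^bsub>F\<^esub> (e v w \<oplus>\<^bsub>F\<^esub> e v' w) | v v' w. v \<in> carrier V \<and> v' \<in> carrier V \<and> w \<in> carrier W} \<union>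
     {e v (w \<oplus>\<^bsub>W\<^esub> w') \<ominus>\<^bsub>F\<^esub> (e v w \<oplus>\<^bsub>F\<^esub> e v w') | v w w'. v \<in> carrier V \<and> w \<in> carrier W \<and> w' \<in> carrier W} \<union>
     {e (a \<odot>\<^bsub>V\<^esub> v) w \<ominus>\<^bsub>F\<^esub> (a \<odot>\<^bsub>F\<^esub> e v w) | a v w. a \<in> carrier K \<and> v \<in> carrier V \<and> w \<in> carrier W} \<union>
     {e v (a \<odot>\<^bsub>W\<^esub> w) \<ominus>\<^bsub>F\<^esub> (a \<odot>\<^bsub>F\<^esub> e v w) | a v w. a \<in> carrier K \<and> v \<in> carrier V \<and> w \<in> carrier W})"

definition tensor_null ::
  "('k, 'r) ring_scheme \<Rightarrow> ('k, 'a, 'm) module_scheme \<Rightarrow> ('k, 'b, 'n) module_scheme \<Rightarrow> ('a \<times> 'b \<Rightarrow> 'k) set"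
  where "tensor_null K V W = lin_span K (free_space K (carrier V \<times> carrier W)) (tensor_rels K V W)"

definition tensor_space ::
  "('k, 'r) ring_scheme \<Rightarrow> ('k, 'a, 'm) module_scheme \<Rightarrow> ('k, 'b, 'n) module_scheme \<Rightarrow> ('k, ('a \<times> 'b \<Rightarrow> 'k) set) module"
  where "tensor_space K V W = quot_space K (free_space K (carrier V \<times> carrier W)) (tensor_null K V W)"

definition pure_tensor ::
  "('k, 'r) ring_scheme \<Rightarrow> ('k, 'a, 'm) module_scheme \<Rightarrow> ('k, 'b, 'n) module_scheme \<Rightarrow> 'a \<Rightarrow> 'b \<Rightarrow> ('a \<times> 'b \<Rightarrow> 'k) set"
  where "pure_tensor K V W v w =
    tensor_null K V W +>\<^bsub>free_space K (carrier V \<times> carrier W)\<^esub> free_gen K (v, w)"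

text \<open>The linear map \<open>V \<otimes> W \<rightarrow> U\<close> induced by a bilinear map \<open>b\<close>, sending
  \<open>\<Sum>\<^sub>i a\<^sub>i (v\<^sub>i \<otimes> w\<^sub>i)\<close> to \<open>\<Sum>\<^sub>i a\<^sub>i b(v\<^sub>i, w\<^sub>i)\<close>.  It is computed on an arbitrary representative of the
  coset; for bilinear \<open>b\<close> this choice is immaterial.  Sweedler-style formulas
  are stated below as lifts of the bilinear maps they describe.\<close>

definition tensor_lift ::
  "('k, 'r) ring_scheme \<Rightarrow> ('k, 'a, 'm) module_scheme \<Rightarrow> ('k, 'b, 'n) module_scheme \<Rightarrow> ('k, 'c, 'l) module_scheme
    \<Rightarrow> ('a \<Rightarrow> 'b \<Rightarrow> 'c) \<Rightarrow> ('a \<times> 'b \<Rightarrow> 'k) set \<Rightarrow> 'c"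
  where "tensor_lift K V W U b X =
    (let f = (SOME f. f \<in> X) in
       \<Oplus>\<^bsub>U\<^esub> p \<in> {p. f p \<noteq> \<zero>\<^bsub>K\<^esub>}. f p \<odot>\<^bsub>U\<^esub> b (fst p) (snd p))"

definition tensor_map ::
  "('k, 'r) ring_scheme \<Rightarrow> ('k, 'a, 'm) module_scheme \<Rightarrow> ('k, 'b, 'n) module_scheme
    \<Rightarrow> ('k, 'c, 'l) module_scheme \<Rightarrow> ('k, 'd, 'o) module_scheme
    \<Rightarrow> ('a \<Rightarrow> 'c) \<Rightarrow> ('b \<Rightarrow> 'd) \<Rightarrow> ('a \<times> 'b \<Rightarrow> 'k) set \<Rightarrow> ('c \<times> 'd \<Rightarrow> 'k) set"
  where "tensor_map K V W V' W' f g =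
    tensor_lift K V W (tensor_space K V' W') (\<lambda>v w. pure_tensor K V' W' (f v) (g w))"

text \<open>The associativity isomorphism \<open>(U \<otimes> V) \<otimes> W \<rightarrow> U \<otimes> (V \<otimes> W)\<close>.\<close>

definition tensor_assoc ::
  "('k, 'r) ring_scheme \<Rightarrow> ('k, 'a, 'm) module_scheme \<Rightarrow> ('k, 'b, 'n) module_scheme \<Rightarrow> ('k, 'c, 'l) module_scheme
    \<Rightarrow> (('a \<times> 'b \<Rightarrow> 'k) set \<times> 'c \<Rightarrow> 'k) set \<Rightarrow> ('a \<times> ('b \<times> 'c \<Rightarrow> 'k) set \<Rightarrow> 'k) set"
  where "tensor_assoc K U V W =
   (let T = tensor_space K U (tensor_space K V W) in
     tensor_lift K (tensor_space K U V) W T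
       (\<lambda>X w. tensor_lift K U V T
         (\<lambda>u v. pure_tensor K U (tensor_space K V W) u (pure_tensor K V W v w)) X))"

text \<open>The subspace \<open>A \<otimes> B\<close> of \<open>V \<otimes> W\<close>, for subspaces \<open>A\<close> of \<open>V\<close> and \<open>B\<close> of \<open>W\<close>: over a field the
  map \<open>A \<otimes> B \<rightarrow> V \<otimes> W\<close> is injective, and this is its image.\<close>

definition tensor_subspace ::
  "('k, 'r) ring_scheme \<Rightarrow> ('k, 'a, 'm) module_scheme \<Rightarrow> ('k, 'b, 'n) module_scheme
    \<Rightarrow> 'a set \<Rightarrow> 'b set \<Rightarrow> ('a \<times> 'b \<Rightarrow> 'k) set set"
  where "tensor_subspace K V W A B =
    lin_span K (tensor_space K V W) {pure_tensor K V W a b | a b. a \<in> A \<and> b \<in> B}"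

text \<open>Componentwise product on \<open>A \<otimes> A\<close> for an algebra \<open>A\<close>: \<open>(a \<otimes> b)(c \<otimes> d) = ac \<otimes> bd\<close>.\<close>

definition tensor_mult ::
  "('k, 'r) ring_scheme \<Rightarrow> ('k, 'a, 'm) module_scheme
    \<Rightarrow> ('a \<times> 'a \<Rightarrow> 'k) set \<Rightarrow> ('a \<times> 'a \<Rightarrow> 'k) set \<Rightarrow> ('a \<times> 'a \<Rightarrow> 'k) set"
  where "tensor_mult K A X Y =
    tensor_lift K A A (tensor_space K A A)
      (\<lambda>a b. tensor_lift K A A (tensor_space K A A)
        (\<lambda>c d. pure_tensor K A A (a \<otimes>\<^bsub>A\<^esub> c) (b \<otimes>\<^bsub>A\<^esub> d)) Y) X"


section \<open>Coalgebras, bialgebras and comodules\<close>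

locale coalgebra = field K + module K C
  for K (structure) and C (structure) +
  fixes \<Delta> :: "'c \<Rightarrow> ('c \<times> 'c \<Rightarrow> 'k) set" and \<epsilon> :: "'c \<Rightarrow> 'k"
  constrains K :: "('k, 'r) ring_scheme" and C :: "('k, 'c, 'm) module_scheme"
  assumes comult_linear: "lin_map K C (tensor_space K C C) \<Delta>"
    and counit_linear: "lin_map K C (ground_space K) \<epsilon>"
    and coassoc: "c \<in> carrier C \<Longrightarrow>
      tensor_assoc K C C C (tensor_map K C C (tensor_space K C C) C \<Delta> id (\<Delta> c))
        = tensor_map K C C C (tensor_space K C C) id \<Delta> (\<Delta> c)"
    and counit_left: "c \<in> carrier C \<Longrightarrow> tensor_lift K C C C (\<lambda>a b. \<epsilon> a \<odot>\<^bsub>C\<^esub> b) (\<Delta> c) = c"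
    and counit_right: "c \<in> carrier C \<Longrightarrow> tensor_lift K C C C (\<lambda>a b. \<epsilon> b \<odot>\<^bsub>C\<^esub> a) (\<Delta> c) = c"

text \<open>The library locale \<^locale>\<open>algebra\<close> is restricted to commutative algebras.\<close>

locale assoc_algebra = field K + module K A + ring A
  for K (structure) and A (structure) +
  assumes smult_mult_left: "\<lbrakk>k \<in> carrier K; x \<in> carrier A; y \<in> carrier A\<rbrakk> \<Longrightarrow>
      (k \<odot>\<^bsub>A\<^esub> x) \<otimes>\<^bsub>A\<^esub> y = k \<odot>\<^bsub>A\<^esub> (x \<otimes>\<^bsub>A\<^esub> y)"
    and smult_mult_right: "\<lbrakk>k \<in> carrier K; x \<in> carrier A; y \<in> carrier A\<rbrakk> \<Longrightarrow>
      x \<otimes>\<^bsub>A\<^esub> (k \<odot>\<^bsub>A\<^esub> y) = k \<odot>\<^bsub>A\<^esub> (x \<otimes>\<^bsub>A\<^esub> y)"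

locale bialgebra = assoc_algebra K H + coalgebra K H \<Delta> \<epsilon>
  for K (structure) and H (structure) and \<Delta> and \<epsilon> +
  assumes comult_mult: "\<lbrakk>x \<in> carrier H; y \<in> carrier H\<rbrakk> \<Longrightarrow> \<Delta> (x \<otimes>\<^bsub>H\<^esub> y) = tensor_mult K H (\<Delta> x) (\<Delta> y)"
    and comult_one: "\<Delta> \<one>\<^bsub>H\<^esub> = pure_tensor K H H \<one>\<^bsub>H\<^esub> \<one>\<^bsub>H\<^esub>"
    and counit_mult: "\<lbrakk>x \<in> carrier H; y \<in> carrier H\<rbrakk> \<Longrightarrow> \<epsilon> (x \<otimes>\<^bsub>H\<^esub> y) = \<epsilon> x \<otimes>\<^bsub>K\<^esub> \<epsilon> y"
    and counit_one: "\<epsilon> \<one>\<^bsub>H\<^esub> = \<one>\<^bsub>K\<^esub>"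

locale right_comodule = H?: coalgebra K H \<Delta>\<^sub>H \<epsilon>\<^sub>H + V?: module K V
  for K (structure) and H (structure) and \<Delta>\<^sub>H and \<epsilon>\<^sub>H and V (structure) +
  fixes \<rho> :: "'v \<Rightarrow> ('v \<times> 'h \<Rightarrow> 'k) set"
  constrains K :: "('k, 'r) ring_scheme" and H :: "('k, 'h, 'l) module_scheme"
    and V :: "('k, 'v, 'm) module_scheme"
  assumes coact_linear: "lin_map K V (tensor_space K V H) \<rho>"
    and coact_coassoc: "v \<in> carrier V \<Longrightarrow>
      tensor_assoc K V H H (tensor_map K V H (tensor_space K V H) H \<rho> id (\<rho> v))
        = tensor_map K V H V (tensor_space K H H) id \<Delta>\<^sub>H (\<rho> v)"
    and coact_counit: "v \<in> carrier V \<Longrightarrow> tensor_lift K V H V (\<lambda>x h. \<epsilon>\<^sub>H h \<odot>\<^bsub>V\<^esub> x) (\<rho> v) = v"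

text \<open>The coaction \<open>v \<otimes> w \<mapsto> v\<^sub>0 \<otimes> w\<^sub>0 \<otimes> v\<^sub>1w\<^sub>1\<close> on the tensor product of two comodules.\<close>

definition tensor_coaction ::
  "('k, 'r) ring_scheme \<Rightarrow> ('k, 'h, 'l) module_scheme
    \<Rightarrow> ('k, 'a, 'm) module_scheme \<Rightarrow> ('a \<Rightarrow> ('a \<times> 'h \<Rightarrow> 'k) set)
    \<Rightarrow> ('k, 'b, 'n) module_scheme \<Rightarrow> ('b \<Rightarrow> ('b \<times> 'h \<Rightarrow> 'k) set)
    \<Rightarrow> ('a \<times> 'b \<Rightarrow> 'k) set \<Rightarrow> (('a \<times> 'b \<Rightarrow> 'k) set \<times> 'h \<Rightarrow> 'k) set"
  where "tensor_coaction K H V \<rho>\<^sub>V W \<rho>\<^sub>W =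
   (let T = tensor_space K (tensor_space K V W) H in
     tensor_lift K V W T
       (\<lambda>v w. tensor_lift K V H T
         (\<lambda>v\<^sub>0 v\<^sub>1. tensor_lift K W H T
           (\<lambda>w\<^sub>0 w\<^sub>1. pure_tensor K (tensor_space K V W) H (pure_tensor K V W v\<^sub>0 w\<^sub>0) (v\<^sub>1 \<otimes>\<^bsub>H\<^esub> w\<^sub>1))
           (\<rho>\<^sub>W w))
         (\<rho>\<^sub>V v)))"

definition unit_coaction ::
  "('k, 'r) ring_scheme \<Rightarrow> ('k, 'h, 'l) module_scheme \<Rightarrow> 'k \<Rightarrow> ('k \<times> 'h \<Rightarrow> 'k) set"
  where "unit_coaction K H k = pure_tensor K (ground_space K) H k \<one>\<^bsub>H\<^esub>"

definition comodule_map ::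
  "('k, 'r) ring_scheme \<Rightarrow> ('k, 'h, 'l) module_scheme
    \<Rightarrow> ('k, 'a, 'm) module_scheme \<Rightarrow> ('a \<Rightarrow> ('a \<times> 'h \<Rightarrow> 'k) set)
    \<Rightarrow> ('k, 'b, 'n) module_scheme \<Rightarrow> ('b \<Rightarrow> ('b \<times> 'h \<Rightarrow> 'k) set) \<Rightarrow> ('a \<Rightarrow> 'b) \<Rightarrow> bool"
  where "comodule_map K H V \<rho>\<^sub>V W \<rho>\<^sub>W f \<longleftrightarrow>
    lin_map K V W f \<and> (\<forall>v \<in> carrier V. \<rho>\<^sub>W (f v) = tensor_map K V H W H f id (\<rho>\<^sub>V v))"

locale comodule_coalgebra =
  H?: bialgebra K H \<Delta>\<^sub>H \<epsilon>\<^sub>H + C?: coalgebra K C \<Delta> \<epsilon> + right_comodule K H \<Delta>\<^sub>H \<epsilon>\<^sub>H C \<rho>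
  for K (structure) and H (structure) and \<Delta>\<^sub>H and \<epsilon>\<^sub>H and C (structure) and \<Delta> and \<epsilon> and \<rho> +
  assumes comult_comodule_map:
      "comodule_map K H C \<rho> (tensor_space K C C) (tensor_coaction K H C \<rho> C \<rho>) \<Delta>"
    and counit_comodule_map:
      "comodule_map K H C \<rho> (ground_space K) (unit_coaction K H) \<epsilon>"

definition subcoalgebra ::
  "('k, 'r) ring_scheme \<Rightarrow> ('k, 'c, 'm) module_scheme \<Rightarrow> ('c \<Rightarrow> ('c \<times> 'c \<Rightarrow> 'k) set) \<Rightarrow> 'c set \<Rightarrow> bool"
  where "subcoalgebra K C \<Delta> D \<longleftrightarrow>
    submodule D K C \<and> (\<forall>d \<in> D. \<Delta> d \<in> tensor_subspace K C C D D)"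

definition subcomodule ::
  "('k, 'r) ring_scheme \<Rightarrow> ('k, 'h, 'l) module_scheme
    \<Rightarrow> ('k, 'v, 'm) module_scheme \<Rightarrow> ('v \<Rightarrow> ('v \<times> 'h \<Rightarrow> 'k) set) \<Rightarrow> 'v set \<Rightarrow> bool"
  where "subcomodule K H V \<rho> D \<longleftrightarrow>
    submodule D K V \<and> (\<forall>d \<in> D. \<rho> d \<in> tensor_subspace K V H D (carrier H))"

end

theory Submission
  imports Defs
begin

text \<open>For functionals \<open>\<phi>\<close> on \<open>C\<close> and \<open>\<theta>\<close> on \<open>H\<close> consider the operators
  \<open>c \<mapsto> \<phi>(c\<^sub>1) c\<^sub>2\<close>, \<open>c \<mapsto> c\<^sub>1 \<phi>(c\<^sub>2)\<close> and \<open>c \<mapsto> c\<^sub>0 \<theta>(c\<^sub>1)\<close> on \<open>C\<close>.  A subspace is a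
  subcoalgebra iff it is stable under the first two kinds, and a subcomodule iff it is stable under the
  third.  By coassociativity each kind is closed under composition and the first two commute, so closing
  \<open>F\<close> under the second kind and then under the first gives a finite-dimensional subcoalgebra \<open>D\<^sub>0\<close>.
  The order of the steps matters: \<open>H\<close> has no antipode, so the subcoalgebra generated by a subcomodule
  need not obviously be a subcomodule, but the subcomodule \<open>D\<close> generated by \<open>D\<^sub>0\<close> is a subcoalgebra.
  Indeed \<open>D \<otimes> D\<close> is a subcomodule of \<open>C \<otimes> C\<close> containing \<open>\<Delta>(D\<^sub>0)\<close>, so the colinear map \<open>\<Delta>\<close> sends \<open>D\<close>
  into it.\<close>

section \<open>Linear maps and subspaces\<close>

text \<open>A tensor is a coset of formal sums, so its legs cannot be read off directly. The
  development works without bases: membership in A \<otimes> B is tested by applying functionals to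
  one leg and looking at what remains in the other. The test is faithful only if functionals
  separate a vector from a subspace; Zorn's lemma supplies them, and division in K enters there. The
  same test controls dimension: one tensor involves finitely many vectors, so all its slices
  together span a finite-dimensional space, although there may be infinitely many functionals. Hence
  a single round of slicing by all functionals keeps finite dimension, and no iteration has to be
  bounded. Each round contains its starting space because the counit is one of the functionals and
  its slice returns the element. The leg in H is never cut down, since H may be
  infinite-dimensional. Identities in Sweedler notation become equalities of linear maps that are
  compared on pure tensors.\<close>

lemma submodule_iff:
  assumes "module K V"
  shows "submodule N K V \<longleftrightarrow> N \<subseteq> carrier V \<and> \<zero>\<^bsub>V\<^esub> \<in> N \<and> (\<forall>x\<in>N. \<forall>y\<in>N. x \<oplus>\<^bsub>V\<^esub> y \<in> N) \<and>
    (\<forall>a\<in>carrier K. \<forall>x\<in>N. a \<odot>\<^bsub>V\<^esub> x \<in> N)"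
proof -
  interpret module K V by fact
  show ?thesis
  proof
    assume N: "submodule N K V"
    then obtain x where "x \<in> N" using submoduleE(2) by blast
    with N have "\<zero>\<^bsub>K\<^esub> \<odot>\<^bsub>V\<^esub> x \<in> N" "x \<in> carrier V" using submoduleE(1,4) by blast+
    then show "N \<subseteq> carrier V \<and> \<zero>\<^bsub>V\<^esub> \<in> N \<and> (\<forall>x\<in>N. \<forall>y\<in>N. x \<oplus>\<^bsub>V\<^esub> y \<in> N) \<and>
    (\<forall>a\<in>carrier K. \<forall>x\<in>N. a \<odot>\<^bsub>V\<^esub> x \<in> N)"
      using submoduleE(1,4,5)[OF N] by auto
  next
    assume N: "N \<subseteq> carrier V \<and> \<zero>\<^bsub>V\<^esub> \<in> N \<and> (\<forall>x\<in>N. \<forall>y\<in>N. x \<oplus>\<^bsub>V\<^esub> y \<in> N) \<and>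
      (\<forall>a\<in>carrier K. \<forall>x\<in>N. a \<odot>\<^bsub>V\<^esub> x \<in> N)"
    \<comment> \<open>Negation is not among the listed closure conditions; it is recovered by
      scaling with the negative of the unit.\<close>
    then have "\<ominus>\<^bsub>V\<^esub> x \<in> N" if "x \<in> N" for x
      using that smult_l_minus[of "\<one>\<^bsub>K\<^esub>" x]
      by (metis R.add.inv_closed R.one_closed smult_one subsetD)
    with N show "submodule N K V" by (intro submoduleI) auto
  qed
qed

lemma
  assumes "module K V" "submodule N K V"
  shows submodule_carrier: "x \<in> N \<Longrightarrow> x \<in> carrier V"
    and submodule_zero: "\<zero>\<^bsub>V\<^esub> \<in> N"
    and submodule_add: "\<lbrakk>x \<in> N; y \<in> N\<rbrakk> \<Longrightarrow> x \<oplus>\<^bsub>V\<^esub> y \<in> N"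
    and submodule_smult: "\<lbrakk>a \<in> carrier K; x \<in> N\<rbrakk> \<Longrightarrow> a \<odot>\<^bsub>V\<^esub> x \<in> N"
    and submodule_minus: "\<lbrakk>x \<in> N; y \<in> N\<rbrakk> \<Longrightarrow> x \<ominus>\<^bsub>V\<^esub> y \<in> N"
  using assms submodule_iff[OF assms(1), of N] module.submoduleE(3,5)[OF assms]
  by (auto simp: a_minus_def)

lemma lin_mapI:
  assumes "\<And>x. x \<in> carrier V \<Longrightarrow> f x \<in> carrier W"
    and "\<And>x y. \<lbrakk>x \<in> carrier V; y \<in> carrier V\<rbrakk> \<Longrightarrow> f (x \<oplus>\<^bsub>V\<^esub> y) = f x \<oplus>\<^bsub>W\<^esub> f y"
    and "\<And>a x. \<lbrakk>a \<in> carrier K; x \<in> carrier V\<rbrakk> \<Longrightarrow> f (a \<odot>\<^bsub>V\<^esub> x) = a \<odot>\<^bsub>W\<^esub> f x"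
  shows "lin_map K V W f"
  using assms unfolding lin_map_def by auto

lemma
  assumes "lin_map K V W f"
  shows lin_map_closed: "x \<in> carrier V \<Longrightarrow> f x \<in> carrier W"
    and lin_map_add: "\<lbrakk>x \<in> carrier V; y \<in> carrier V\<rbrakk> \<Longrightarrow> f (x \<oplus>\<^bsub>V\<^esub> y) = f x \<oplus>\<^bsub>W\<^esub> f y"
    and lin_map_smult: "\<lbrakk>a \<in> carrier K; x \<in> carrier V\<rbrakk> \<Longrightarrow> f (a \<odot>\<^bsub>V\<^esub> x) = a \<odot>\<^bsub>W\<^esub> f x"
  using assms unfolding lin_map_def by auto

lemma lin_map_zero:
  assumes V: "module K V" and W: "module K W" and f: "lin_map K V W f"
  shows "f \<zero>\<^bsub>V\<^esub> = \<zero>\<^bsub>W\<^esub>"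
proof -
  interpret V: module K V by fact
  interpret W: module K W by fact
  have "f (\<zero>\<^bsub>K\<^esub> \<odot>\<^bsub>V\<^esub> \<zero>\<^bsub>V\<^esub>) = \<zero>\<^bsub>K\<^esub> \<odot>\<^bsub>W\<^esub> f \<zero>\<^bsub>V\<^esub>" by (rule lin_map_smult[OF f]) auto
  then show ?thesis using lin_map_closed[OF f, of "\<zero>\<^bsub>V\<^esub>"] by simp
qed

lemma lin_map_minus:
  assumes V: "module K V" and W: "module K W" and f: "lin_map K V W f"
    and x: "x \<in> carrier V" and y: "y \<in> carrier V"
  shows "f (x \<ominus>\<^bsub>V\<^esub> y) = f x \<ominus>\<^bsub>W\<^esub> f y"
proof -
  interpret V: module K V by fact
  interpret W: module K W by fact
  have "f (x \<ominus>\<^bsub>V\<^esub> y) \<oplus>\<^bsub>W\<^esub> f y = f x"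
    using lin_map_add[OF f, of "x \<ominus>\<^bsub>V\<^esub> y" y] x y by (simp add: V.minus_eq V.a_assoc V.l_neg)
  then show ?thesis using lin_map_closed[OF f] x y
    by (metis V.minus_closed W.minus_eq W.add.inv_solve_right)
qed

lemma lin_map_comp:
  "\<lbrakk>lin_map K U V f; lin_map K V W g\<rbrakk> \<Longrightarrow> lin_map K U W (\<lambda>x. g (f x))"
  unfolding lin_map_def by (auto simp: Pi_def)

lemma lin_map_id: "lin_map K V V (\<lambda>x. x)"
  unfolding lin_map_def by auto

lemma lin_map_plus:
  assumes W: "module K W" and f: "lin_map K V W f" and g: "lin_map K V W g"
  shows "lin_map K V W (\<lambda>x. f x \<oplus>\<^bsub>W\<^esub> g x)"
proof -
  interpret W: module K W by fact
  show ?thesis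
    by (rule lin_mapI)
      (auto simp: lin_map_closed[OF f] lin_map_closed[OF g] lin_map_add[OF f] lin_map_add[OF g]
        lin_map_smult[OF f] lin_map_smult[OF g] W.smult_r_distr W.add.m_ac)
qed

lemma lin_map_scale:
  assumes W: "module K W" and f: "lin_map K V W f" and a: "a \<in> carrier K"
  shows "lin_map K V W (\<lambda>x. a \<odot>\<^bsub>W\<^esub> f x)"
proof -
  interpret W: module K W by fact
  show ?thesis
    by (rule lin_mapI)
      (use a in \<open>auto simp: lin_map_closed[OF f] lin_map_add[OF f]
        lin_map_smult[OF f] W.smult_r_distr W.smult_assoc1[symmetric] W.m_comm\<close>)
qed

lemma lin_map_zero_map:
  assumes W: "module K W"
  shows "lin_map K V W (\<lambda>x. \<zero>\<^bsub>W\<^esub>)"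
proof -
  interpret W: module K W by fact
  show ?thesis by (rule lin_mapI) auto
qed

lemma lin_map_vimage:
  assumes V: "module K V" and W: "module K W" and f: "lin_map K V W f" and N: "submodule N K W"
  shows "submodule {x \<in> carrier V. f x \<in> N} K V"
proof -
  interpret V: module K V by fact
  show ?thesis unfolding submodule_iff[OF V]
    by (auto simp: lin_map_add[OF f] lin_map_smult[OF f] lin_map_zero[OF V W f]
        submodule_zero[OF W N] submodule_add[OF W N] submodule_smult[OF W N])
qed

lemma lin_map_eq_submodule:
  assumes V: "module K V" and W: "module K W" and f: "lin_map K V W f" and g: "lin_map K V W g"
  shows "submodule {x \<in> carrier V. f x = g x} K V"
proof -
  interpret V: module K V by fact
  show ?thesis unfolding submodule_iff[OF V]
    by (auto simp: lin_map_add[OF f] lin_map_smult[OF f] lin_map_zero[OF V W f]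
       lin_map_add[OF g] lin_map_smult[OF g] lin_map_zero[OF V W g])
qed

section \<open>Linear spans\<close>

lemma lin_span_superset: "S \<subseteq> lin_span K V S"
  unfolding lin_span_def by auto

lemma lin_span_least: "\<lbrakk>submodule N K V; S \<subseteq> N\<rbrakk> \<Longrightarrow> lin_span K V S \<subseteq> N"
  unfolding lin_span_def by auto

lemma lin_span_submodule:
  assumes V: "module K V" and S: "S \<subseteq> carrier V"
  shows "submodule (lin_span K V S) K V"
proof -
  interpret V: module K V by fact
  have "lin_span K V S \<subseteq> carrier V"
    by (rule lin_span_least[OF V.carrier_is_submodule S])
  then show ?thesis
    unfolding submodule_iff[OF V] unfolding lin_span_def
    by (auto simp: submodule_zero[OF V] submodule_add[OF V] submodule_smult[OF V])
qed

lemma lin_span_mono: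
  assumes V: "module K V" and "S \<subseteq> T" and "T \<subseteq> carrier V"
  shows "lin_span K V S \<subseteq> lin_span K V T"
  using assms lin_span_least lin_span_submodule lin_span_superset by (metis dual_order.trans)

text \<open>Spans are intersections, so no linear combination is at hand. The vectors of the desired
  shape form a subspace containing all generators, and the span is the least such subspace.\<close>

lemma lin_span_insert:
  assumes V: "module K V" and S: "S \<subseteq> carrier V" and w: "w \<in> carrier V"
    and x: "x \<in> lin_span K V (insert w S)"
  shows "\<exists>a\<in>carrier K. \<exists>y\<in>lin_span K V S. x = a \<odot>\<^bsub>V\<^esub> w \<oplus>\<^bsub>V\<^esub> y"
proof -
  interpret V: module K V by fact
  note sp = lin_span_submodule[OF V S]
  let ?N = "{a \<odot>\<^bsub>V\<^esub> w \<oplus>\<^bsub>V\<^esub> y | a y. a \<in> carrier K \<and> y \<in> lin_span K V S}"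
  have cl: "y \<in> carrier V" if "y \<in> lin_span K V S" for y
    using that submodule_carrier[OF V sp] by blast
  have "submodule ?N K V"
    unfolding submodule_iff[OF V]
  proof (intro conjI ballI)
    show "?N \<subseteq> carrier V" using w cl by auto
    show "\<zero>\<^bsub>V\<^esub> \<in> ?N" using w submodule_zero[OF V sp] by (force intro!: exI[of _ "\<zero>\<^bsub>K\<^esub>"])
    fix u assume "u \<in> ?N"
    then obtain a y where u: "u = a \<odot>\<^bsub>V\<^esub> w \<oplus>\<^bsub>V\<^esub> y" "a \<in> carrier K" "y \<in> lin_span K V S" by auto
    {
      fix v assume "v \<in> ?N"
      then obtain b z where v: "v = b \<odot>\<^bsub>V\<^esub> w \<oplus>\<^bsub>V\<^esub> z" "b \<in> carrier K" "z \<in> lin_span K V S" by auto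
      have "u \<oplus>\<^bsub>V\<^esub> v = (a \<oplus>\<^bsub>K\<^esub> b) \<odot>\<^bsub>V\<^esub> w \<oplus>\<^bsub>V\<^esub> (y \<oplus>\<^bsub>V\<^esub> z)"
        using u v w cl by (simp add: V.smult_l_distr V.add.m_ac)
      then show "u \<oplus>\<^bsub>V\<^esub> v \<in> ?N" using u v submodule_add[OF V sp] by blast
    }
    fix c assume "c \<in> carrier K"
    then have "c \<odot>\<^bsub>V\<^esub> u = (c \<otimes>\<^bsub>K\<^esub> a) \<odot>\<^bsub>V\<^esub> w \<oplus>\<^bsub>V\<^esub> (c \<odot>\<^bsub>V\<^esub> y)"
      using u w cl by (simp add: V.smult_assoc1 V.smult_r_distr)
    then show "c \<odot>\<^bsub>V\<^esub> u \<in> ?N" using u \<open>c \<in> carrier K\<close> submodule_smult[OF V sp] by blast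
  qed
  moreover have "insert w S \<subseteq> ?N"
  proof -
    have "w = \<one>\<^bsub>K\<^esub> \<odot>\<^bsub>V\<^esub> w \<oplus>\<^bsub>V\<^esub> \<zero>\<^bsub>V\<^esub>" using w by simp
    moreover have "y = \<zero>\<^bsub>K\<^esub> \<odot>\<^bsub>V\<^esub> w \<oplus>\<^bsub>V\<^esub> y" if "y \<in> S" for y using that S w by auto
    ultimately show ?thesis
      using submodule_zero[OF V sp] lin_span_superset[of S K V]
      by (smt (verit, best) V.one_closed V.R.zero_closed insert_iff mem_Collect_eq subset_iff)
  qed
  ultimately show ?thesis using lin_span_least[of ?N K V "insert w S"] x by blast
qed

text \<open>The vectors reached from finite subsets form a subspace, because two finite subsets have
  a finite union. This takes the place of writing out a finite linear combination.\<close>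

lemma lin_span_finite_subset:
  assumes V: "module K V" and S: "S \<subseteq> carrier V" and x: "x \<in> lin_span K V S"
  shows "\<exists>T. finite T \<and> T \<subseteq> S \<and> x \<in> lin_span K V T"
proof -
  interpret V: module K V by fact
  define N where "N = {x. \<exists>T. finite T \<and> T \<subseteq> S \<and> x \<in> lin_span K V T}"
  have sub: "submodule (lin_span K V T) K V" if "T \<subseteq> S" for T
    using lin_span_submodule[OF V subset_trans[OF that S]] .
  have I: "x \<in> N" if "finite T" "T \<subseteq> S" "x \<in> lin_span K V T" for x T
    unfolding N_def using that by blast
  have E: "\<exists>T. finite T \<and> T \<subseteq> S \<and> x \<in> lin_span K V T" if "x \<in> N" for x
    using that unfolding N_def by blast
  have "submodule N K V"
    unfolding submodule_iff[OF V]
  proof (intro conjI ballI subsetI)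
    fix x assume "x \<in> N"
    then obtain T where T: "finite T" "T \<subseteq> S" "x \<in> lin_span K V T" using E by metis
    show "x \<in> carrier V" by (rule submodule_carrier[OF V sub[OF T(2)] T(3)])
    show "a \<odot>\<^bsub>V\<^esub> x \<in> N" if "a \<in> carrier K" for a
      by (rule I[OF T(1,2) submodule_smult[OF V sub[OF T(2)] that T(3)]])
    fix y assume "y \<in> N"
    then obtain T' where T': "finite T'" "T' \<subseteq> S" "y \<in> lin_span K V T'" using E by metis
    have TT: "T \<union> T' \<subseteq> S" "T \<union> T' \<subseteq> carrier V" using T(2) T'(2) S by (simp_all add: subset_trans)
    have "x \<in> lin_span K V (T \<union> T')"
      by (rule subsetD[OF lin_span_mono[OF V Un_upper1 TT(2)] T(3)])
    moreover have "y \<in> lin_span K V (T \<union> T')"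
      by (rule subsetD[OF lin_span_mono[OF V Un_upper2 TT(2)] T'(3)])
    ultimately show "x \<oplus>\<^bsub>V\<^esub> y \<in> N"
      using I[OF _ TT(1) submodule_add[OF V sub[OF TT(1)]]] T(1) T'(1) by simp
  next
    show "\<zero>\<^bsub>V\<^esub> \<in> N" by (rule I[OF _ _ submodule_zero[OF V sub[of "{}"]]]) simp_all
  qed
  moreover have "S \<subseteq> N"
  proof
    fix x assume "x \<in> S"
    then show "x \<in> N" using lin_span_superset[of "{x}" K V] by (intro I[of "{x}"]) simp_all
  qed
  ultimately have "x \<in> N" using x lin_span_least by blast
  then show ?thesis by (rule E)
qed

section \<open>The ground field and separating functionals\<close>

lemma module_ground_space:
  assumes "cring K"
  shows "module K (ground_space K)"
proof -
  interpret K: cring K by fact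
  show ?thesis
  proof (rule moduleI)
    show "abelian_group (ground_space K)"
      by (rule abelian_groupI)
        (auto simp: ground_space_def K.add.m_ac intro: bexI[of _ "\<ominus>\<^bsub>K\<^esub> _"] K.l_neg)
  qed (auto simp: ground_space_def K.is_cring K.l_distr K.r_distr K.m_assoc)
qed

lemma ground_space_simps:
  "carrier (ground_space K) = carrier K" "x \<oplus>\<^bsub>ground_space K\<^esub> y = x \<oplus>\<^bsub>K\<^esub> y"
  "\<zero>\<^bsub>ground_space K\<^esub> = \<zero>\<^bsub>K\<^esub>" "a \<odot>\<^bsub>ground_space K\<^esub> x = a \<otimes>\<^bsub>K\<^esub> x"
  by (auto simp: ground_space_def)

text \<open>Choosing, by Zorn, a subspace \<open>M \<supseteq> N\<close> maximal among those that avoid \<open>w\<close> makes \<open>M\<close> a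
  hyperplane with complement spanned by \<open>w\<close>; the functional is the \<open>w\<close>-coordinate.\<close>

lemma separating_functional:
  assumes K: "field K" and V: "module K V" and N: "submodule N K V"
    and w: "w \<in> carrier V" "w \<notin> N"
  shows "\<exists>\<phi>. lin_map K V (ground_space K) \<phi> \<and> \<phi> w = \<one>\<^bsub>K\<^esub> \<and> (\<forall>x\<in>N. \<phi> x = \<zero>\<^bsub>K\<^esub>)"
proof -
  interpret K: field K by fact
  interpret V: module K V by fact
  have mz: "\<ominus>\<^bsub>V\<^esub> \<zero>\<^bsub>V\<^esub> = \<zero>\<^bsub>V\<^esub>" using V.r_neg[of "\<zero>\<^bsub>V\<^esub>"] by simp
  let ?A = "{M. submodule M K V \<and> N \<subseteq> M \<and> w \<notin> M}"
  have "\<exists>M\<in>?A. \<forall>X\<in>?A. M \<subseteq> X \<longrightarrow> X = M"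
  proof (rule subset_Zorn_nonempty)
    show "?A \<noteq> {}" using N w by auto
    fix \<C> assume ne: "\<C> \<noteq> {}" and ch: "subset.chain ?A \<C>"
    have sub: "submodule M K V" "N \<subseteq> M" "w \<notin> M" if "M \<in> \<C>" for M
      using ch that unfolding subset.chain_def by auto
    have "submodule (\<Union>\<C>) K V"
      unfolding submodule_iff[OF V]
    proof (intro conjI ballI)
      show "\<Union>\<C> \<subseteq> carrier V" using sub(1) submodule_carrier[OF V] by blast
      show "\<zero>\<^bsub>V\<^esub> \<in> \<Union>\<C>" using ne sub(1) submodule_zero[OF V] by blast
      fix x assume "x \<in> \<Union>\<C>"
      then obtain M where M: "M \<in> \<C>" "x \<in> M" by auto
      {
        fix y assume "y \<in> \<Union>\<C>"
        then obtain M' where M': "M' \<in> \<C>" "y \<in> M'" by auto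
        then have "M \<subseteq> M' \<or> M' \<subseteq> M" using ch M unfolding subset_chain_def by blast
        then show "x \<oplus>\<^bsub>V\<^esub> y \<in> \<Union>\<C>" using M M' sub(1) submodule_add[OF V] by blast
      }
      fix a assume "a \<in> carrier K"
      then show "a \<odot>\<^bsub>V\<^esub> x \<in> \<Union>\<C>" using M sub(1) submodule_smult[OF V] by blast
    qed
    then show "\<Union>\<C> \<in> ?A" using sub ne by blast
  qed
  then obtain M where M: "submodule M K V" "N \<subseteq> M" "w \<notin> M"
    and max: "\<And>X. \<lbrakk>submodule X K V; N \<subseteq> X; w \<notin> X; M \<subseteq> X\<rbrakk> \<Longrightarrow> X = M" by auto
  note Mc = submodule_carrier[OF V M(1)]
  have ex: "\<exists>a\<in>carrier K. x \<ominus>\<^bsub>V\<^esub> a \<odot>\<^bsub>V\<^esub> w \<in> M" if x: "x \<in> carrier V" for x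
  proof (cases "x \<in> M")
    case True
    then show ?thesis using w x by (intro bexI[of _ "\<zero>\<^bsub>K\<^esub>"]) (auto simp: V.minus_eq mz)
  next
    case False
    have Mcar: "M \<subseteq> carrier V" using Mc by auto
    let ?X = "lin_span K V (insert x M)"
    have X: "submodule ?X K V" using lin_span_submodule[OF V] x Mcar by simp
    have sup: "insert x M \<subseteq> ?X" by (rule lin_span_superset)
    \<comment> \<open>By maximality, adjoining \<open>x\<close> to \<open>M\<close> must capture
      \<open>w\<close>. In the resulting \<open>w = a x + y\<close> the scalar \<open>a\<close> is
      nonzero, since otherwise \<open>w\<close> would lie in \<open>M\<close>; so the equation can
      be solved for \<open>x\<close>.\<close>
    then have "w \<in> ?X" using max[OF X] False M(2) by blast
    then obtain a y where ay: "a \<in> carrier K" "y \<in> lin_span K V M" "w = a \<odot>\<^bsub>V\<^esub> x \<oplus>\<^bsub>V\<^esub> y"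
      using lin_span_insert[OF V Mcar x] by blast
    then have y: "y \<in> M" using lin_span_least[OF M(1), of M] by auto
    have "a \<noteq> \<zero>\<^bsub>K\<^esub>" using ay y M(3) x Mc by auto
    then have inv: "inv\<^bsub>K\<^esub> a \<in> carrier K" "inv\<^bsub>K\<^esub> a \<otimes>\<^bsub>K\<^esub> a = \<one>\<^bsub>K\<^esub>" using ay K.field_Units by auto
    have "x = inv\<^bsub>K\<^esub> a \<odot>\<^bsub>V\<^esub> (a \<odot>\<^bsub>V\<^esub> x)" using inv ay x by (simp add: V.smult_assoc1[symmetric])
    also have "a \<odot>\<^bsub>V\<^esub> x = w \<ominus>\<^bsub>V\<^esub> y" using ay x Mc[OF y]
      by (simp add: V.minus_eq V.a_assoc V.r_neg)
    also have "inv\<^bsub>K\<^esub> a \<odot>\<^bsub>V\<^esub> (w \<ominus>\<^bsub>V\<^esub> y) = inv\<^bsub>K\<^esub> a \<odot>\<^bsub>V\<^esub> w \<oplus>\<^bsub>V\<^esub> \<ominus>\<^bsub>V\<^esub> (inv\<^bsub>K\<^esub> a \<odot>\<^bsub>V\<^esub> y)"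
      using inv w Mc[OF y] by (simp add: V.minus_eq V.smult_r_distr V.smult_r_minus)
    finally have "x \<ominus>\<^bsub>V\<^esub> inv\<^bsub>K\<^esub> a \<odot>\<^bsub>V\<^esub> w = \<ominus>\<^bsub>V\<^esub> (inv\<^bsub>K\<^esub> a \<odot>\<^bsub>V\<^esub> y)"
      using inv w Mc[OF y] by (simp add: V.minus_eq V.add.m_ac V.r_neg1 V.r_neg2)
    moreover have "\<ominus>\<^bsub>V\<^esub> (inv\<^bsub>K\<^esub> a \<odot>\<^bsub>V\<^esub> y) \<in> M"
      using V.submoduleE(3)[OF M(1)] submodule_smult[OF V M(1)] inv y by blast
    ultimately show ?thesis using inv by (metis (no_types))
  qed
  \<comment> \<open>Two different coefficients would put a nonzero multiple of \<open>w\<close> into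
    \<open>M\<close>, and dividing by \<open>a - b\<close> would put \<open>w\<close> itself
    there.\<close>
  have uniq: "a = b" if "a \<in> carrier K" "b \<in> carrier K" "x \<in> carrier V"
    "x \<ominus>\<^bsub>V\<^esub> a \<odot>\<^bsub>V\<^esub> w \<in> M" "x \<ominus>\<^bsub>V\<^esub> b \<odot>\<^bsub>V\<^esub> w \<in> M" for a b x
  proof (rule ccontr)
    assume ne: "a \<noteq> b"
    have "(x \<ominus>\<^bsub>V\<^esub> b \<odot>\<^bsub>V\<^esub> w) \<ominus>\<^bsub>V\<^esub> (x \<ominus>\<^bsub>V\<^esub> a \<odot>\<^bsub>V\<^esub> w) \<in> M"
      using submodule_minus[OF V M(1)] that by blast
    also have "(x \<ominus>\<^bsub>V\<^esub> b \<odot>\<^bsub>V\<^esub> w) \<ominus>\<^bsub>V\<^esub> (x \<ominus>\<^bsub>V\<^esub> a \<odot>\<^bsub>V\<^esub> w) = a \<odot>\<^bsub>V\<^esub> w \<ominus>\<^bsub>V\<^esub> b \<odot>\<^bsub>V\<^esub> w"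
    proof -
      have "(x \<oplus>\<^bsub>V\<^esub> p) \<oplus>\<^bsub>V\<^esub> (y \<oplus>\<^bsub>V\<^esub> q) = (x \<oplus>\<^bsub>V\<^esub> y) \<oplus>\<^bsub>V\<^esub> (q \<oplus>\<^bsub>V\<^esub> p)"
        if "p \<in> carrier V" "q \<in> carrier V" "y \<in> carrier V" for p q y
        using that \<open>x \<in> carrier V\<close> by (simp add: V.add.m_ac)
      from this[of "\<ominus>\<^bsub>V\<^esub> (b \<odot>\<^bsub>V\<^esub> w)" "a \<odot>\<^bsub>V\<^esub> w" "\<ominus>\<^bsub>V\<^esub> x"] show ?thesis
        using that(1-3) w(1) by (simp add: V.minus_eq V.minus_add V.r_neg)
    qed
    also have "\<dots> = (a \<ominus>\<^bsub>K\<^esub> b) \<odot>\<^bsub>V\<^esub> w"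
      using that w by (simp add: V.minus_eq K.minus_eq V.smult_l_distr V.smult_l_minus)
    finally have "(a \<ominus>\<^bsub>K\<^esub> b) \<odot>\<^bsub>V\<^esub> w \<in> M" .
    moreover have "a \<ominus>\<^bsub>K\<^esub> b \<in> Units K"
    proof -
      have "a = (a \<ominus>\<^bsub>K\<^esub> b) \<oplus>\<^bsub>K\<^esub> b" using that(1,2) by (simp add: K.minus_eq K.a_assoc K.l_neg)
      then have "a \<ominus>\<^bsub>K\<^esub> b \<noteq> \<zero>\<^bsub>K\<^esub>" using ne that(1,2) by (metis K.l_zero)
      then show ?thesis using that(1,2) K.minus_closed[of a b] by (simp add: K.field_Units)
    qed
    ultimately have "inv\<^bsub>K\<^esub> (a \<ominus>\<^bsub>K\<^esub> b) \<odot>\<^bsub>V\<^esub> ((a \<ominus>\<^bsub>K\<^esub> b) \<odot>\<^bsub>V\<^esub> w) \<in> M"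
      using submodule_smult[OF V M(1)] by blast
    then show False using \<open>a \<ominus>\<^bsub>K\<^esub> b \<in> Units K\<close> w M(3) K.Units_closed[OF \<open>a \<ominus>\<^bsub>K\<^esub> b \<in> Units K\<close>]
      by (simp add: V.smult_assoc1[symmetric])
  qed
  \<comment> \<open>The chosen coefficient is the only possible one, so each value and each
    linearity law below is proved by exhibiting a scalar that satisfies the membership
    condition.\<close>
  define \<phi> where "\<phi> x = (SOME a. a \<in> carrier K \<and> x \<ominus>\<^bsub>V\<^esub> a \<odot>\<^bsub>V\<^esub> w \<in> M)" for x
  have "\<phi> x \<in> carrier K \<and> x \<ominus>\<^bsub>V\<^esub> \<phi> x \<odot>\<^bsub>V\<^esub> w \<in> M" if "x \<in> carrier V" for x
    unfolding \<phi>_def by (rule someI_ex) (use ex[OF that] in blast)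
  then have \<phi>: "\<phi> x \<in> carrier K" "x \<ominus>\<^bsub>V\<^esub> \<phi> x \<odot>\<^bsub>V\<^esub> w \<in> M" if "x \<in> carrier V" for x
    using that by blast+
  have eq: "\<phi> x = a" if "x \<in> carrier V" "a \<in> carrier K" "x \<ominus>\<^bsub>V\<^esub> a \<odot>\<^bsub>V\<^esub> w \<in> M" for x a
    using uniq[OF \<phi>(1)[OF that(1)] that(2,1) \<phi>(2)[OF that(1)] that(3)] .
  have "lin_map K V (ground_space K) \<phi>"
  proof (rule lin_mapI)
    fix x y assume xy: "x \<in> carrier V" "y \<in> carrier V"
    have "(x \<ominus>\<^bsub>V\<^esub> \<phi> x \<odot>\<^bsub>V\<^esub> w) \<oplus>\<^bsub>V\<^esub> (y \<ominus>\<^bsub>V\<^esub> \<phi> y \<odot>\<^bsub>V\<^esub> w) \<in> M"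
      using submodule_add[OF V M(1)] \<phi> xy by blast
    also have "(x \<ominus>\<^bsub>V\<^esub> \<phi> x \<odot>\<^bsub>V\<^esub> w) \<oplus>\<^bsub>V\<^esub> (y \<ominus>\<^bsub>V\<^esub> \<phi> y \<odot>\<^bsub>V\<^esub> w)
      = (x \<oplus>\<^bsub>V\<^esub> y) \<ominus>\<^bsub>V\<^esub> (\<phi> x \<oplus>\<^bsub>K\<^esub> \<phi> y) \<odot>\<^bsub>V\<^esub> w"
      using xy \<phi>(1) w by (simp add: V.minus_eq V.smult_l_distr V.minus_add V.add.m_ac)
    finally show "\<phi> (x \<oplus>\<^bsub>V\<^esub> y) = \<phi> x \<oplus>\<^bsub>ground_space K\<^esub> \<phi> y"
      using xy \<phi>(1) by (intro eq) (auto simp: ground_space_simps)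
  next
    fix a x assume ax: "a \<in> carrier K" "x \<in> carrier V"
    have "a \<odot>\<^bsub>V\<^esub> (x \<ominus>\<^bsub>V\<^esub> \<phi> x \<odot>\<^bsub>V\<^esub> w) \<in> M"
      using submodule_smult[OF V M(1)] \<phi> ax by blast
    also have "a \<odot>\<^bsub>V\<^esub> (x \<ominus>\<^bsub>V\<^esub> \<phi> x \<odot>\<^bsub>V\<^esub> w) = a \<odot>\<^bsub>V\<^esub> x \<ominus>\<^bsub>V\<^esub> (a \<otimes>\<^bsub>K\<^esub> \<phi> x) \<odot>\<^bsub>V\<^esub> w"
      using ax \<phi>(1) w by (simp add: V.minus_eq V.smult_r_distr V.smult_r_minus V.smult_assoc1)
    finally show "\<phi> (a \<odot>\<^bsub>V\<^esub> x) = a \<odot>\<^bsub>ground_space K\<^esub> \<phi> x"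
      using ax \<phi>(1) by (intro eq) (auto simp: ground_space_simps)
  qed (use \<phi> in \<open>simp add: ground_space_simps\<close>)
  moreover have "\<phi> w = \<one>\<^bsub>K\<^esub>"
    using w submodule_zero[OF V M(1)] by (intro eq) (auto simp: V.minus_eq V.r_neg)
  moreover have "\<phi> x = \<zero>\<^bsub>K\<^esub>" if "x \<in> N" for x
    using w M(2) Mc that by (intro eq) (auto simp: V.minus_eq mz)
  ultimately show ?thesis by (intro exI[of _ \<phi>] conjI ballI)
qed

section \<open>Free spaces and quotients\<close>

lemma module_free_space:
  fixes K :: "('k, 'r) ring_scheme" and S :: "'x set"
  assumes "cring K"
  shows "module K (free_space K S)"
proof -
  interpret K: cring K by fact
  have fin: "finite {x. f x \<oplus>\<^bsub>K\<^esub> g x \<noteq> \<zero>\<^bsub>K\<^esub>}"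
    if "finite {x. f x \<noteq> \<zero>\<^bsub>K\<^esub>}" "finite {x. g x \<noteq> \<zero>\<^bsub>K\<^esub>}" for f g :: "'x \<Rightarrow> 'k"
    by (rule finite_subset[OF _ finite_UnI[OF that]]) auto
  have fin2: "finite {x. a \<otimes>\<^bsub>K\<^esub> f x \<noteq> \<zero>\<^bsub>K\<^esub>}"
    if "a \<in> carrier K" "finite {x. f x \<noteq> \<zero>\<^bsub>K\<^esub>}" for a and f :: "'x \<Rightarrow> 'k"
    by (rule finite_subset[OF _ that(2)]) (use that in auto)
  have car: "f x \<in> carrier K" if "\<forall>x\<in>S. f x \<in> carrier K" "\<forall>x. x \<notin> S \<longrightarrow> f x = \<zero>\<^bsub>K\<^esub>" for f x
    using that by (cases "x \<in> S") auto
  show ?thesis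
  proof (rule moduleI)
    show "abelian_group (free_space K S)"
    proof (rule abelian_groupI)
      fix f assume f: "f \<in> carrier (free_space K S)"
      have "finite {x. \<ominus>\<^bsub>K\<^esub> f x \<noteq> \<zero>\<^bsub>K\<^esub>}"
        by (rule finite_subset[of _ "{x. f x \<noteq> \<zero>\<^bsub>K\<^esub>}"]) (use f in \<open>auto simp: free_space_def\<close>)
      then show "\<exists>y\<in>carrier (free_space K S). y \<oplus>\<^bsub>free_space K S\<^esub> f = \<zero>\<^bsub>free_space K S\<^esub>"
        using f by (intro bexI[of _ "\<lambda>x. \<ominus>\<^bsub>K\<^esub> f x"]) (auto simp: free_space_def K.l_neg car)
    qed (auto simp: free_space_def K.add.m_ac fin car)
  qed (auto simp: free_space_def K.is_cring K.l_distr K.r_distr K.m_assoc fin fin2 car)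
qed

lemma free_gen_closed:
  assumes "cring K" "p \<in> S"
  shows "free_gen K p \<in> carrier (free_space K S)"
proof -
  interpret K: cring K by fact
  have "finite {x. (if x = p then \<one>\<^bsub>K\<^esub> else \<zero>\<^bsub>K\<^esub>) \<noteq> \<zero>\<^bsub>K\<^esub>}"
    by (rule finite_subset[of _ "{p}"]) auto
  then show ?thesis using assms(2) by (auto simp: free_space_def free_gen_def)
qed

text \<open>Induction on a finite set containing the support: one coordinate is set to zero, and the
  removed part is a multiple of a generator.\<close>

lemma free_space_in_submodule:
  assumes K: "cring K" and N: "submodule N K (free_space K S)"
    and gen: "\<And>p. p \<in> S \<Longrightarrow> free_gen K p \<in> N" and f: "f \<in> carrier (free_space K S)"
  shows "f \<in> N"
proof -
  interpret K: cring K by fact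
  note F = module_free_space[OF K, of S]
  have "f \<in> N" if "finite A" "f \<in> carrier (free_space K S)" "{x. f x \<noteq> \<zero>\<^bsub>K\<^esub>} \<subseteq> A" for A f
    using that
  proof (induction A arbitrary: f rule: finite_induct)
    case empty
    then have "f = \<zero>\<^bsub>free_space K S\<^esub>" by (auto simp: free_space_def)
    then show ?case using submodule_zero[OF F N] by simp
  next
    case (insert p A)
    let ?g = "f(p := \<zero>\<^bsub>K\<^esub>)"
    have supp: "{x. ?g x \<noteq> \<zero>\<^bsub>K\<^esub>} \<subseteq> A"
      using insert.prems by auto
    have "?g \<in> carrier (free_space K S)"
      using insert.prems finite_subset[OF supp \<open>finite A\<close>] by (auto simp: free_space_def)
    then have "?g \<in> N" using supp by (rule insert.IH)
    moreover have "f p \<odot>\<^bsub>free_space K S\<^esub> free_gen K p \<in> N" if "p \<in> S"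
      using insert.prems that by (intro submodule_smult[OF F N] gen) (auto simp: free_space_def)
    moreover have "f = ?g \<oplus>\<^bsub>free_space K S\<^esub> (f p \<odot>\<^bsub>free_space K S\<^esub> free_gen K p)" if "p \<in> S"
    proof
      fix x
      have "f x \<in> carrier K" using insert.prems by (cases "x \<in> S") (auto simp: free_space_def)
      then show "f x = (?g \<oplus>\<^bsub>free_space K S\<^esub> (f p \<odot>\<^bsub>free_space K S\<^esub> free_gen K p)) x"
        using insert.prems that by (auto simp: free_space_def free_gen_def)
    qed
    moreover have "f = ?g" if "p \<notin> S" using insert.prems that by (auto simp: free_space_def)
    ultimately show ?case using submodule_add[OF F N] by metis
  qed
  from this[OF _ f order.refl] f show ?thesis by (simp add: free_space_def)
qed

text \<open>The sum inside \<open>tensor_lift\<close>, detached from the choice of a coset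
  representative.\<close>

definition free_lift ::
  "('k, 'r) ring_scheme \<Rightarrow> ('k, 'u, 'l) module_scheme \<Rightarrow> ('x \<Rightarrow> 'u) \<Rightarrow> ('x \<Rightarrow> 'k) \<Rightarrow> 'u"
  where "free_lift K U b f = (\<Oplus>\<^bsub>U\<^esub> p \<in> {p. f p \<noteq> \<zero>\<^bsub>K\<^esub>}. f p \<odot>\<^bsub>U\<^esub> b p)"

context
  fixes K :: "('k, 'r) ring_scheme" and U :: "('k, 'u, 'l) module_scheme"
    and S :: "'x set" and b :: "'x \<Rightarrow> 'u"
  assumes U: "module K U" and b: "\<And>p. p \<in> S \<Longrightarrow> b p \<in> carrier U"
begin

interpretation U: module K U by (rule U)

text \<open>Supports change under addition and scaling. Enlarging the index set by zero terms lets
  both sides of a linearity law be summed over the same set.\<close>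

lemma free_lift_superset:
  assumes "f \<in> carrier (free_space K S)" "finite A" "{p. f p \<noteq> \<zero>\<^bsub>K\<^esub>} \<subseteq> A" "A \<subseteq> S"
  shows "free_lift K U b f = (\<Oplus>\<^bsub>U\<^esub> p \<in> A. f p \<odot>\<^bsub>U\<^esub> b p)"
  unfolding free_lift_def
  by (rule U.add.finprod_mono_neutral_cong_left)
    (use assms b in \<open>auto simp: free_space_def Pi_def\<close>)

lemma free_lift_linear: "lin_map K (free_space K S) U (free_lift K U b)"
proof -
  interpret F: module K "free_space K S" by (rule module_free_space[OF U.R.is_cring])
  have supp: "finite {p. f p \<noteq> \<zero>\<^bsub>K\<^esub>}" "{p. f p \<noteq> \<zero>\<^bsub>K\<^esub>} \<subseteq> S" "\<And>p. p \<in> S \<Longrightarrow> f p \<in> carrier K"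
    if "f \<in> carrier (free_space K S)" for f
    using that by (auto simp: free_space_def)
  show ?thesis
  proof (rule lin_mapI)
    fix f assume f: "f \<in> carrier (free_space K S)"
    show "free_lift K U b f \<in> carrier U" unfolding free_lift_def
      using supp[OF f] b by (intro U.finsum_closed) auto
    {
      fix g assume g: "g \<in> carrier (free_space K S)"
      let ?A = "{p. f p \<noteq> \<zero>\<^bsub>K\<^esub>} \<union> {p. g p \<noteq> \<zero>\<^bsub>K\<^esub>}"
      have fg: "f \<oplus>\<^bsub>free_space K S\<^esub> g \<in> carrier (free_space K S)" using f g by simp
      have A: "finite ?A" "?A \<subseteq> S" using supp[OF f] supp[OF g] by auto
      have "free_lift K U b (f \<oplus>\<^bsub>free_space K S\<^esub> g)
        = (\<Oplus>\<^bsub>U\<^esub> p \<in> ?A. (f \<oplus>\<^bsub>free_space K S\<^esub> g) p \<odot>\<^bsub>U\<^esub> b p)"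
        using A by (intro free_lift_superset[OF fg]) (auto simp: free_space_def)
      also have "\<dots> = (\<Oplus>\<^bsub>U\<^esub> p \<in> ?A. f p \<odot>\<^bsub>U\<^esub> b p \<oplus>\<^bsub>U\<^esub> g p \<odot>\<^bsub>U\<^esub> b p)"
        using A(2) supp[OF f] supp[OF g] b
        by (intro U.finsum_cong' refl) (auto simp: free_space_def intro!: U.smult_l_distr)
      also have "\<dots> = (\<Oplus>\<^bsub>U\<^esub> p \<in> ?A. f p \<odot>\<^bsub>U\<^esub> b p) \<oplus>\<^bsub>U\<^esub> (\<Oplus>\<^bsub>U\<^esub> p \<in> ?A. g p \<odot>\<^bsub>U\<^esub> b p)"
        using A supp(3)[OF f] supp(3)[OF g] b by (intro U.finsum_addf) auto
      also have "\<dots> = free_lift K U b f \<oplus>\<^bsub>U\<^esub> free_lift K U b g"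
        using free_lift_superset[OF f A(1) _ A(2)] free_lift_superset[OF g A(1) _ A(2)] by auto
      finally show "free_lift K U b (f \<oplus>\<^bsub>free_space K S\<^esub> g) = free_lift K U b f \<oplus>\<^bsub>U\<^esub> free_lift K U b g" .
    }
    fix a assume a: "a \<in> carrier K"
    let ?A = "{p. f p \<noteq> \<zero>\<^bsub>K\<^esub>}"
    have af: "a \<odot>\<^bsub>free_space K S\<^esub> f \<in> carrier (free_space K S)" using a f by simp
    have "free_lift K U b (a \<odot>\<^bsub>free_space K S\<^esub> f)
      = (\<Oplus>\<^bsub>U\<^esub> p \<in> ?A. (a \<odot>\<^bsub>free_space K S\<^esub> f) p \<odot>\<^bsub>U\<^esub> b p)"
      using supp[OF f] a by (intro free_lift_superset[OF af]) (auto simp: free_space_def)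
    also have "\<dots> = (\<Oplus>\<^bsub>U\<^esub> p \<in> ?A. a \<odot>\<^bsub>U\<^esub> (f p \<odot>\<^bsub>U\<^esub> b p))"
      using a supp[OF f] b
      by (intro U.finsum_cong' refl) (auto simp: free_space_def U.smult_assoc1 subset_iff)
    also have "\<dots> = a \<odot>\<^bsub>U\<^esub> free_lift K U b f" unfolding free_lift_def
      using a supp[OF f] b by (intro U.finsum_smult_ldistr[symmetric]) auto
    finally show "free_lift K U b (a \<odot>\<^bsub>free_space K S\<^esub> f) = a \<odot>\<^bsub>U\<^esub> free_lift K U b f" .
  qed
qed

lemma free_lift_gen:
  assumes p: "p \<in> S"
  shows "free_lift K U b (free_gen K p) = b p"
proof -
  have "free_lift K U b (free_gen K p) = (\<Oplus>\<^bsub>U\<^esub> q \<in> {p}. free_gen K p q \<odot>\<^bsub>U\<^esub> b q)"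
    using p by (intro free_lift_superset free_gen_closed) (auto simp: free_gen_def U.R.is_cring)
  also have "\<dots> = b p" using b[OF p] by (simp add: free_gen_def)
  finally show ?thesis .
qed

end

context
  fixes K :: "('k, 'r) ring_scheme" and V :: "('k, 'a, 'm) module_scheme" and N :: "'a set"
  assumes V: "module K V" and N: "submodule N K V"
begin

interpretation V: module K V by (rule V)

lemma submodule_abelian_subgroup: "abelian_subgroup N V"
  using N by (intro abelian_subgroupI3 additive_subgroupI)
    (auto simp: submodule_def V.abelian_group_axioms)

interpretation N: abelian_subgroup N V by (rule submodule_abelian_subgroup)

lemma quot_space_carrier: "carrier (quot_space K V N) = {N +>\<^bsub>V\<^esub> x | x. x \<in> carrier V}"
  by (auto simp: quot_space_def A_RCOSETS_def')

lemma coset_mem_iff: "x \<in> carrier V \<Longrightarrow> y \<in> N +>\<^bsub>V\<^esub> x \<longleftrightarrow> (\<exists>n\<in>N. y = n \<oplus>\<^bsub>V\<^esub> x)"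
  by (auto simp: a_r_coset_def')

lemma quot_space_add:
  "\<lbrakk>x \<in> carrier V; y \<in> carrier V\<rbrakk> \<Longrightarrow>
    (N +>\<^bsub>V\<^esub> x) \<oplus>\<^bsub>quot_space K V N\<^esub> (N +>\<^bsub>V\<^esub> y) = N +>\<^bsub>V\<^esub> (x \<oplus>\<^bsub>V\<^esub> y)"
  by (simp add: quot_space_def N.a_rcos_sum)

text \<open>The scalar action on a coset is defined as a union over its representatives. All of them
  give the same coset, so the union is that of a constant family.\<close>

lemma quot_space_smult:
  assumes a: "a \<in> carrier K" and x: "x \<in> carrier V"
  shows "a \<odot>\<^bsub>quot_space K V N\<^esub> (N +>\<^bsub>V\<^esub> x) = N +>\<^bsub>V\<^esub> (a \<odot>\<^bsub>V\<^esub> x)"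
proof -
  have "N +>\<^bsub>V\<^esub> (a \<odot>\<^bsub>V\<^esub> y) = N +>\<^bsub>V\<^esub> (a \<odot>\<^bsub>V\<^esub> x)" if y: "y \<in> N +>\<^bsub>V\<^esub> x" for y
  proof -
    obtain n where n: "n \<in> N" "y = n \<oplus>\<^bsub>V\<^esub> x" using y x by (auto simp: coset_mem_iff)
    then have "n \<in> carrier V" using submodule_carrier[OF V N] by blast
    then have "a \<odot>\<^bsub>V\<^esub> y = a \<odot>\<^bsub>V\<^esub> n \<oplus>\<^bsub>V\<^esub> a \<odot>\<^bsub>V\<^esub> x" using n a x by (simp add: V.smult_r_distr)
    then have "a \<odot>\<^bsub>V\<^esub> y \<in> N +>\<^bsub>V\<^esub> (a \<odot>\<^bsub>V\<^esub> x)"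
      using coset_mem_iff[of "a \<odot>\<^bsub>V\<^esub> x"] a x n submodule_smult[OF V N] by auto
    then show ?thesis using a x by (intro N.a_repr_independence'[symmetric]) auto
  qed
  moreover have "x \<in> N +>\<^bsub>V\<^esub> x" using x by (rule N.a_rcos_self)
  ultimately have "(\<Union>y \<in> N +>\<^bsub>V\<^esub> x. N +>\<^bsub>V\<^esub> (a \<odot>\<^bsub>V\<^esub> y)) = N +>\<^bsub>V\<^esub> (a \<odot>\<^bsub>V\<^esub> x)"
    by (intro SUP_eq_const) blast+
  then show ?thesis by (simp add: quot_space_def)
qed

lemma quot_space_zero: "\<zero>\<^bsub>quot_space K V N\<^esub> = N +>\<^bsub>V\<^esub> \<zero>\<^bsub>V\<^esub>"
  by (simp add: quot_space_def V.a_coset_add_zero N.a_subset)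

lemma module_quot_space: "module K (quot_space K V N)"
proof (rule moduleI)
  show "abelian_group (quot_space K V N)"
  proof (rule abelian_groupI)
    fix X assume "X \<in> carrier (quot_space K V N)"
    then obtain x where "X = N +>\<^bsub>V\<^esub> x" "x \<in> carrier V" by (auto simp: quot_space_carrier)
    then show "\<exists>Y\<in>carrier (quot_space K V N). Y \<oplus>\<^bsub>quot_space K V N\<^esub> X = \<zero>\<^bsub>quot_space K V N\<^esub>"
      by (intro bexI[of _ "N +>\<^bsub>V\<^esub> (\<ominus>\<^bsub>V\<^esub> x)"])
        (auto simp: quot_space_carrier quot_space_add quot_space_zero V.l_neg)
  qed (auto simp: quot_space_carrier quot_space_add quot_space_zero V.add.m_ac)
qed (auto simp: quot_space_carrier quot_space_add quot_space_smult V.R.is_cring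
    V.smult_l_distr V.smult_r_distr V.smult_assoc1)

lemma quot_map_linear: "lin_map K V (quot_space K V N) (\<lambda>x. N +>\<^bsub>V\<^esub> x)"
  by (rule lin_mapI) (auto simp: quot_space_carrier quot_space_add quot_space_smult)

end

section \<open>Tensor products\<close>

definition bilin_map ::
  "('k, 'r) ring_scheme \<Rightarrow> ('k, 'a, 'm) module_scheme \<Rightarrow> ('k, 'b, 'n) module_scheme
    \<Rightarrow> ('k, 'c, 'l) module_scheme \<Rightarrow> ('a \<Rightarrow> 'b \<Rightarrow> 'c) \<Rightarrow> bool"
  where "bilin_map K V W U b \<longleftrightarrow>
    (\<forall>w\<in>carrier W. lin_map K V U (\<lambda>v. b v w)) \<and> (\<forall>v\<in>carrier V. lin_map K W U (b v))"

lemma bilin_mapI: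
  assumes "\<And>w. w \<in> carrier W \<Longrightarrow> lin_map K V U (\<lambda>v. b v w)"
    and "\<And>v. v \<in> carrier V \<Longrightarrow> lin_map K W U (b v)"
  shows "bilin_map K V W U b"
  using assms unfolding bilin_map_def by blast

lemma
  assumes "bilin_map K V W U b"
  shows bilin_map_left: "w \<in> carrier W \<Longrightarrow> lin_map K V U (\<lambda>v. b v w)"
    and bilin_map_right: "v \<in> carrier V \<Longrightarrow> lin_map K W U (b v)"
  using assms unfolding bilin_map_def by blast+

lemma bilin_map_closed:
  "\<lbrakk>bilin_map K V W U b; v \<in> carrier V; w \<in> carrier W\<rbrakk> \<Longrightarrow> b v w \<in> carrier U"
  by (rule lin_map_closed[OF bilin_map_right])

lemma bilin_map_comp:
  assumes b: "bilin_map K V W U b" and f: "lin_map K U X f"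
  shows "bilin_map K V W X (\<lambda>v w. f (b v w))"
  by (intro bilin_mapI lin_map_comp[OF _ f] bilin_map_left[OF b] bilin_map_right[OF b])

lemma bilin_map_precomp:
  assumes b: "bilin_map K V' W' U b" and f: "lin_map K V V' f" and g: "lin_map K W W' g"
  shows "bilin_map K V W U (\<lambda>v w. b (f v) (g w))"
  by (intro bilin_mapI lin_map_comp[OF f bilin_map_left[OF b]] lin_map_comp[OF g bilin_map_right[OF b]]
      lin_map_closed[OF f] lin_map_closed[OF g])

lemma lin_map_smult_right:
  assumes V: "module K V" and a: "a \<in> carrier K"
  shows "lin_map K V V (\<lambda>x. a \<odot>\<^bsub>V\<^esub> x)"
  by (rule lin_map_scale[OF V lin_map_id a])

lemma lin_map_smult_left:
  assumes V: "module K V" and x: "x \<in> carrier V"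
  shows "lin_map K (ground_space K) V (\<lambda>a. a \<odot>\<^bsub>V\<^esub> x)"
proof -
  interpret V: module K V by fact
  show ?thesis using x by (intro lin_mapI) (auto simp: ground_space_simps V.smult_l_distr V.smult_assoc1)
qed

lemma bilin_map_smult: "module K V \<Longrightarrow> bilin_map K (ground_space K) V V (smult V)"
  by (intro bilin_mapI lin_map_smult_left lin_map_smult_right) (auto simp: ground_space_simps)

lemma bilin_map_functional_smult:
  assumes W: "module K W" and \<phi>: "lin_map K V (ground_space K) \<phi>"
  shows "bilin_map K V W W (\<lambda>v w. \<phi> v \<odot>\<^bsub>W\<^esub> w)"
proof (rule bilin_mapI)
  show "lin_map K V W (\<lambda>v. \<phi> v \<odot>\<^bsub>W\<^esub> w)" if "w \<in> carrier W" for w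
    by (rule lin_map_comp[OF \<phi> lin_map_smult_left[OF W that]])
  show "lin_map K W W (\<lambda>w. \<phi> v \<odot>\<^bsub>W\<^esub> w)" if "v \<in> carrier V" for v
    using lin_map_closed[OF \<phi> that] by (intro lin_map_smult_right[OF W]) (simp add: ground_space_simps)
qed

lemma bilin_map_flip: "bilin_map K V W U b \<Longrightarrow> bilin_map K W V U (\<lambda>w v. b v w)"
  unfolding bilin_map_def by auto

section \<open>Universal property of the tensor product\<close>

context
  fixes K :: "('k, 'r) ring_scheme" and V :: "('k, 'a, 'm) module_scheme"
    and W :: "('k, 'b, 'n) module_scheme"
  assumes V: "module K V" and W: "module K W"
begin

interpretation V: module K V by (rule V)
interpretation W: module K W by (rule W)

private abbreviation (input) "FVW \<equiv> free_space K (carrier V \<times> carrier W)"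

interpretation F: module K FVW by (rule module_free_space[OF V.R.is_cring])

lemma tensor_gen_closed:
  "\<lbrakk>v \<in> carrier V; w \<in> carrier W\<rbrakk> \<Longrightarrow> free_gen K (v, w) \<in> carrier FVW"
  by (rule free_gen_closed[OF V.R.is_cring]) auto

lemma tensor_rels_closed: "tensor_rels K V W \<subseteq> carrier FVW"
  unfolding tensor_rels_def Let_def by (auto intro!: tensor_gen_closed F.minus_closed F.a_closed F.smult_closed)

lemma tensor_null_submodule: "submodule (tensor_null K V W) K FVW"
  unfolding tensor_null_def
  by (rule lin_span_submodule[OF F.module_axioms tensor_rels_closed])

lemma module_tensor_space: "module K (tensor_space K V W)"
  unfolding tensor_space_def by (rule module_quot_space[OF F.module_axioms tensor_null_submodule])

lemma tensor_space_carrier: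
  "carrier (tensor_space K V W) = {tensor_null K V W +>\<^bsub>FVW\<^esub> f | f. f \<in> carrier FVW}"
  unfolding tensor_space_def by (rule quot_space_carrier[OF F.module_axioms tensor_null_submodule])

lemma tensor_proj_linear:
  "lin_map K FVW (tensor_space K V W) (\<lambda>f. tensor_null K V W +>\<^bsub>FVW\<^esub> f)"
  unfolding tensor_space_def by (rule quot_map_linear[OF F.module_axioms tensor_null_submodule])

interpretation T: module K "tensor_space K V W" by (rule module_tensor_space)

lemma pure_tensor_closed:
  "\<lbrakk>v \<in> carrier V; w \<in> carrier W\<rbrakk> \<Longrightarrow> pure_tensor K V W v w \<in> carrier (tensor_space K V W)"
  unfolding pure_tensor_def by (rule lin_map_closed[OF tensor_proj_linear tensor_gen_closed])

text \<open>Converts each defining relation into an equality of cosets, which is how bilinearity of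
  \<open>pure_tensor\<close> is obtained.\<close>

lemma tensor_relation:
  assumes f: "f \<in> carrier FVW" and g: "g \<in> carrier FVW" and rel: "f \<ominus>\<^bsub>FVW\<^esub> g \<in> tensor_rels K V W"
  shows "tensor_null K V W +>\<^bsub>FVW\<^esub> f = tensor_null K V W +>\<^bsub>FVW\<^esub> g"
proof -
  interpret N: abelian_subgroup "tensor_null K V W" FVW
    by (rule submodule_abelian_subgroup[OF F.module_axioms tensor_null_submodule])
  have "f \<ominus>\<^bsub>FVW\<^esub> g \<in> tensor_null K V W"
    unfolding tensor_null_def by (rule subsetD[OF lin_span_superset rel])
  moreover have "f = (f \<ominus>\<^bsub>FVW\<^esub> g) \<oplus>\<^bsub>FVW\<^esub> g" using f g by (simp add: F.minus_eq F.a_assoc F.l_neg)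
  ultimately have "f \<in> tensor_null K V W +>\<^bsub>FVW\<^esub> g"
    using coset_mem_iff[OF F.module_axioms tensor_null_submodule g] by (metis (no_types))
  then show ?thesis using g by (intro N.a_repr_independence'[symmetric])
qed

lemma
  assumes "v \<in> carrier V" "w \<in> carrier W"
  shows tensor_rels_add_left: "v' \<in> carrier V \<Longrightarrow>
      free_gen K (v \<oplus>\<^bsub>V\<^esub> v', w) \<ominus>\<^bsub>FVW\<^esub> (free_gen K (v, w) \<oplus>\<^bsub>FVW\<^esub> free_gen K (v', w)) \<in> tensor_rels K V W"
    and tensor_rels_add_right: "w' \<in> carrier W \<Longrightarrow>
      free_gen K (v, w \<oplus>\<^bsub>W\<^esub> w') \<ominus>\<^bsub>FVW\<^esub> (free_gen K (v, w) \<oplus>\<^bsub>FVW\<^esub> free_gen K (v, w')) \<in> tensor_rels K V W"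
    and tensor_rels_smult_left: "a \<in> carrier K \<Longrightarrow>
      free_gen K (a \<odot>\<^bsub>V\<^esub> v, w) \<ominus>\<^bsub>FVW\<^esub> (a \<odot>\<^bsub>FVW\<^esub> free_gen K (v, w)) \<in> tensor_rels K V W"
    and tensor_rels_smult_right: "a \<in> carrier K \<Longrightarrow>
      free_gen K (v, a \<odot>\<^bsub>W\<^esub> w) \<ominus>\<^bsub>FVW\<^esub> (a \<odot>\<^bsub>FVW\<^esub> free_gen K (v, w)) \<in> tensor_rels K V W"
  unfolding tensor_rels_def Let_def using assms by blast+

lemma bilin_map_pure_tensor: "bilin_map K V W (tensor_space K V W) (pure_tensor K V W)"
proof (intro bilin_mapI lin_mapI)
  note gen = tensor_gen_closed F.a_closed F.smult_closed
  note proj = lin_map_add[OF tensor_proj_linear, symmetric] lin_map_smult[OF tensor_proj_linear, symmetric]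
  fix v w assume v: "v \<in> carrier V" and w: "w \<in> carrier W"
  show "pure_tensor K V W v w \<in> carrier (tensor_space K V W)" by (rule pure_tensor_closed[OF v w])
  then show "pure_tensor K V W v w \<in> carrier (tensor_space K V W)" .
  show "pure_tensor K V W (v \<oplus>\<^bsub>V\<^esub> v') w = pure_tensor K V W v w \<oplus>\<^bsub>tensor_space K V W\<^esub> pure_tensor K V W v' w"
    if v': "v' \<in> carrier V" for v'
    using tensor_relation[OF _ _ tensor_rels_add_left[OF v w v']] v w v'
    by (simp add: pure_tensor_def proj gen)
  show "pure_tensor K V W v (w \<oplus>\<^bsub>W\<^esub> w') = pure_tensor K V W v w \<oplus>\<^bsub>tensor_space K V W\<^esub> pure_tensor K V W v w'"
    if w': "w' \<in> carrier W" for w'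
    using tensor_relation[OF _ _ tensor_rels_add_right[OF v w w']] v w w'
    by (simp add: pure_tensor_def proj gen)
  fix a assume a: "a \<in> carrier K"
  show "pure_tensor K V W (a \<odot>\<^bsub>V\<^esub> v) w = a \<odot>\<^bsub>tensor_space K V W\<^esub> pure_tensor K V W v w"
    using tensor_relation[OF _ _ tensor_rels_smult_left[OF v w a]] v w a
    by (simp add: pure_tensor_def proj gen)
  show "pure_tensor K V W v (a \<odot>\<^bsub>W\<^esub> w) = a \<odot>\<^bsub>tensor_space K V W\<^esub> pure_tensor K V W v w"
    using tensor_relation[OF _ _ tensor_rels_smult_right[OF v w a]] v w a
    by (simp add: pure_tensor_def proj gen)
qed

text \<open>The preimage of \<open>N\<close> under the coset projection is a subspace of the free
  space containing every generator, hence everything. This is the induction principle for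
  tensors.\<close>

lemma tensor_space_in_submodule:
  assumes N: "submodule N K (tensor_space K V W)"
    and pure: "\<And>v w. \<lbrakk>v \<in> carrier V; w \<in> carrier W\<rbrakk> \<Longrightarrow> pure_tensor K V W v w \<in> N"
    and X: "X \<in> carrier (tensor_space K V W)"
  shows "X \<in> N"
proof -
  let ?P = "\<lambda>f. tensor_null K V W +>\<^bsub>FVW\<^esub> f"
  obtain f where f: "f \<in> carrier FVW" "X = ?P f"
    using X unfolding tensor_space_carrier by (elim CollectE exE conjE) (rule that)
  have "f \<in> {f \<in> carrier FVW. ?P f \<in> N}"
  proof (rule free_space_in_submodule[OF V.R.is_cring
        lin_map_vimage[OF F.module_axioms T.module_axioms tensor_proj_linear N] _ f(1)])
    fix p assume "p \<in> carrier V \<times> carrier W"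
    then show "free_gen K p \<in> {f \<in> carrier FVW. ?P f \<in> N}"
      using tensor_gen_closed pure[unfolded pure_tensor_def] by (cases p) simp
  qed
  then show ?thesis using f(2) by simp
qed

text \<open>The equalizer of two linear maps is a subspace, so agreement on pure tensors suffices.
  Most of the later identities rest on this.\<close>

lemma tensor_lin_map_eqI:
  assumes U: "module K U" and f: "lin_map K (tensor_space K V W) U f"
    and g: "lin_map K (tensor_space K V W) U g"
    and eq: "\<And>v w. \<lbrakk>v \<in> carrier V; w \<in> carrier W\<rbrakk> \<Longrightarrow> f (pure_tensor K V W v w) = g (pure_tensor K V W v w)"
    and X: "X \<in> carrier (tensor_space K V W)"
  shows "f X = g X"
  using tensor_space_in_submodule[OF lin_map_eq_submodule[OF T.module_axioms U f g] _ X]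
    eq pure_tensor_closed by auto

context
  fixes U :: "('k, 'c, 'l) module_scheme" and b :: "'a \<Rightarrow> 'b \<Rightarrow> 'c"
  assumes U: "module K U" and b: "bilin_map K V W U b"
begin

interpretation U: module K U by (rule U)

private abbreviation (input) "L \<equiv> free_lift K U (\<lambda>p. b (fst p) (snd p))"

private lemma lift_gen_closed: "p \<in> carrier V \<times> carrier W \<Longrightarrow> b (fst p) (snd p) \<in> carrier U"
  using bilin_map_closed[OF b] by auto

private lemma lift_linear: "lin_map K FVW U L"
  by (rule free_lift_linear[OF U lift_gen_closed])

private lemma lift_gen: "\<lbrakk>v \<in> carrier V; w \<in> carrier W\<rbrakk> \<Longrightarrow> L (free_gen K (v, w)) = b v w"
  using free_lift_gen[OF U lift_gen_closed, where p = "(v, w)"] by simp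

text \<open>Every defining relation is a difference of two formal sums on which \<open>L\<close>
  agrees by bilinearity. So \<open>L\<close> vanishes on the relations and on their span: the lift
  is well defined.\<close>

private lemma lift_null:
  assumes "f \<in> tensor_null K V W"
  shows "L f = \<zero>\<^bsub>U\<^esub>"
proof -
  have ker: "L (f \<ominus>\<^bsub>FVW\<^esub> g) = \<zero>\<^bsub>U\<^esub>" if "f \<in> carrier FVW" "g \<in> carrier FVW" "L f = L g" for f g
    using that lin_map_closed[OF lift_linear]
    by (simp add: lin_map_minus[OF F.module_axioms U lift_linear] U.minus_eq U.r_neg)
  note gen = tensor_gen_closed F.a_closed F.smult_closed
  note bl = bilin_map_left[OF b] bilin_map_right[OF b]
  have "tensor_rels K V W \<subseteq> {f \<in> carrier FVW. L f = \<zero>\<^bsub>U\<^esub>}"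
  proof
    fix f assume f: "f \<in> tensor_rels K V W"
    then have "L f = \<zero>\<^bsub>U\<^esub>"
      unfolding tensor_rels_def Let_def
      by (elim UnE CollectE exE conjE)
        (simp only:, rule ker;
          simp add: gen lin_map_add[OF lift_linear] lin_map_smult[OF lift_linear] lift_gen
            lin_map_add[OF bl(1)] lin_map_smult[OF bl(1)] lin_map_add[OF bl(2)] lin_map_smult[OF bl(2)])+
    with f tensor_rels_closed show "f \<in> {f \<in> carrier FVW. L f = \<zero>\<^bsub>U\<^esub>}" by auto
  qed
  then have "tensor_null K V W \<subseteq> {f \<in> carrier FVW. L f = \<zero>\<^bsub>U\<^esub>}"
    unfolding tensor_null_def
    by (intro lin_span_least
      lin_map_eq_submodule[OF F.module_axioms U lift_linear lin_map_zero_map[OF U]])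
  then show ?thesis using assms by auto
qed

text \<open>The representative picked by \<open>SOME\<close> differs from \<open>f\<close> by an
  element of the null space, which \<open>L\<close> kills. From here on the choice
  disappears.\<close>

private lemma tensor_lift_coset:
  assumes f: "f \<in> carrier FVW"
  shows "tensor_lift K V W U b (tensor_null K V W +>\<^bsub>FVW\<^esub> f) = L f"
proof -
  interpret N: abelian_subgroup "tensor_null K V W" FVW
    by (rule submodule_abelian_subgroup[OF F.module_axioms tensor_null_submodule])
  let ?X = "tensor_null K V W +>\<^bsub>FVW\<^esub> f"
  have "f \<in> ?X" using f by (rule N.a_rcos_self)
  then have "(SOME g. g \<in> ?X) \<in> ?X" by (rule someI[of "\<lambda>g. g \<in> ?X"])
  then obtain n where n: "n \<in> tensor_null K V W" "(SOME g. g \<in> ?X) = n \<oplus>\<^bsub>FVW\<^esub> f"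
    unfolding a_r_coset_def' by auto
  have nc: "n \<in> carrier FVW" using n(1) submodule_carrier[OF F.module_axioms tensor_null_submodule] by blast
  have "tensor_lift K V W U b ?X = L (n \<oplus>\<^bsub>FVW\<^esub> f)"
    unfolding tensor_lift_def n(2) Let_def free_lift_def ..
  also have "\<dots> = L f"
    using lin_map_add[OF lift_linear nc f] lift_null[OF n(1)] lin_map_closed[OF lift_linear f] by simp
  finally show ?thesis .
qed

lemma tensor_lift_linear: "lin_map K (tensor_space K V W) U (tensor_lift K V W U b)"
proof -
  note proj = lin_map_add[OF tensor_proj_linear, symmetric] lin_map_smult[OF tensor_proj_linear, symmetric]
  show ?thesis
    by (rule lin_mapI)
      (auto simp: tensor_space_carrier proj tensor_lift_coset lin_map_closed[OF lift_linear]
        lin_map_add[OF lift_linear] lin_map_smult[OF lift_linear])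
qed

lemma tensor_lift_pure:
  "\<lbrakk>v \<in> carrier V; w \<in> carrier W\<rbrakk> \<Longrightarrow> tensor_lift K V W U b (pure_tensor K V W v w) = b v w"
  unfolding pure_tensor_def using tensor_lift_coset tensor_gen_closed lift_gen by simp

lemma tensor_lift_eqI:
  assumes "lin_map K (tensor_space K V W) U f"
    and "\<And>v w. \<lbrakk>v \<in> carrier V; w \<in> carrier W\<rbrakk> \<Longrightarrow> f (pure_tensor K V W v w) = b v w"
    and "X \<in> carrier (tensor_space K V W)"
  shows "tensor_lift K V W U b X = f X"
  by (rule tensor_lin_map_eqI[OF U tensor_lift_linear assms(1) _ assms(3)])
    (simp add: tensor_lift_pure assms(2))

end

lemma tensor_lift_comp:
  assumes U: "module K U" and b: "bilin_map K V W U b" and Y: "module K Y" and g: "lin_map K U Y g"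
    and X: "X \<in> carrier (tensor_space K V W)"
  shows "tensor_lift K V W Y (\<lambda>v w. g (b v w)) X = g (tensor_lift K V W U b X)"
  by (rule tensor_lift_eqI[OF Y bilin_map_comp[OF b g] lin_map_comp[OF tensor_lift_linear[OF U b] g]])
    (simp_all add: tensor_lift_pure[OF U b] X)

text \<open>A lift whose bilinear map depends linearly on a parameter is linear in that parameter
  too: for fixed parameters both sides are linear in the tensor and agree on pure tensors. This
  makes nested lifts, as in \<open>tensor_assoc\<close> and \<open>tensor_coaction\<close>, well
  behaved.\<close>

lemma bilin_map_tensor_lift:
  assumes U: "module K U" and Z: "module K Z"
    and b: "\<And>z. z \<in> carrier Z \<Longrightarrow> bilin_map K V W U (t z)"
    and lin: "\<And>v w. \<lbrakk>v \<in> carrier V; w \<in> carrier W\<rbrakk> \<Longrightarrow> lin_map K Z U (\<lambda>z. t z v w)"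
  shows "bilin_map K Z (tensor_space K V W) U (\<lambda>z. tensor_lift K V W U (t z))"
proof (rule bilin_mapI)
  interpret Z: module K Z by fact
  fix X assume X: "X \<in> carrier (tensor_space K V W)"
  show "lin_map K Z U (\<lambda>z. tensor_lift K V W U (t z) X)"
  proof (rule lin_mapI)
    fix z assume z: "z \<in> carrier Z"
    note lz = tensor_lift_linear[OF U b[OF z]]
    show "tensor_lift K V W U (t z) X \<in> carrier U" by (rule lin_map_closed[OF lz X])
    {
      fix z' assume z': "z' \<in> carrier Z"
      show "tensor_lift K V W U (t (z \<oplus>\<^bsub>Z\<^esub> z')) X =
        tensor_lift K V W U (t z) X \<oplus>\<^bsub>U\<^esub> tensor_lift K V W U (t z') X"
        using z z' X
        by (intro tensor_lift_eqI[OF U _ lin_map_plus[OF U lz tensor_lift_linear[OF U b[OF z']]]])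
          (simp_all add: tensor_lift_pure[OF U] b lin_map_add[OF lin])
    }
    fix a assume a: "a \<in> carrier K"
    show "tensor_lift K V W U (t (a \<odot>\<^bsub>Z\<^esub> z)) X = a \<odot>\<^bsub>U\<^esub> tensor_lift K V W U (t z) X"
      using z a X
      by (intro tensor_lift_eqI[OF U _ lin_map_scale[OF U lz]])
        (simp_all add: tensor_lift_pure[OF U] b lin_map_smult[OF lin])
  qed
qed (rule tensor_lift_linear[OF U b])

end

lemma bilin_map_tensor_map:
  assumes "module K V'" "module K W'" "lin_map K V V' f" "lin_map K W W' g"
  shows "bilin_map K V W (tensor_space K V' W') (\<lambda>v w. pure_tensor K V' W' (f v) (g w))"
  by (rule bilin_map_precomp[OF bilin_map_pure_tensor[OF assms(1,2)] assms(3,4)])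

context
  fixes K :: "('k, 'r) ring_scheme" and V :: "('k, 'a, 'm) module_scheme" and W :: "('k, 'b, 'n) module_scheme"
    and V' :: "('k, 'c, 'l) module_scheme" and W' :: "('k, 'd, 'o) module_scheme" and f g
  assumes V: "module K V" and W: "module K W" and V': "module K V'" and W': "module K W'"
    and f: "lin_map K V V' f" and g: "lin_map K W W' g"
begin

lemma tensor_map_linear:
  "lin_map K (tensor_space K V W) (tensor_space K V' W') (tensor_map K V W V' W' f g)"
  unfolding tensor_map_def
  by (rule tensor_lift_linear[OF V W module_tensor_space[OF V' W'] bilin_map_tensor_map[OF V' W' f g]])

lemma tensor_map_pure:
  "\<lbrakk>v \<in> carrier V; w \<in> carrier W\<rbrakk> \<Longrightarrow>
    tensor_map K V W V' W' f g (pure_tensor K V W v w) = pure_tensor K V' W' (f v) (g w)"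
  unfolding tensor_map_def
  by (rule tensor_lift_pure[OF V W module_tensor_space[OF V' W'] bilin_map_tensor_map[OF V' W' f g]])

lemma tensor_lift_tensor_map:
  assumes U: "module K U" and b: "bilin_map K V' W' U b" and X: "X \<in> carrier (tensor_space K V W)"
  shows "tensor_lift K V' W' U b (tensor_map K V W V' W' f g X) = tensor_lift K V W U (\<lambda>v w. b (f v) (g w)) X"
proof (rule tensor_lift_eqI[OF V W U, symmetric])
  show "bilin_map K V W U (\<lambda>v w. b (f v) (g w))"
    by (rule bilin_map_precomp[OF b f g])
  show "lin_map K (tensor_space K V W) U (\<lambda>X. tensor_lift K V' W' U b (tensor_map K V W V' W' f g X))"
    by (rule lin_map_comp[OF tensor_map_linear tensor_lift_linear[OF V' W' U b]])
qed (simp_all add: tensor_map_pure tensor_lift_pure[OF V' W' U b] lin_map_closed[OF f] lin_map_closed[OF g] X)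

end

section \<open>Slices of tensors\<close>

text \<open>The slices of \<open>X \<in> U\<close> by functionals on \<open>V\<close>.  The product \<open>b\<close> is \<open>v \<otimes> w\<close> in one use and
  \<open>w \<otimes> v\<close> in the other, so that both legs of a tensor product are covered.\<close>

locale slicing =
  fixes K :: "('k, 'r) ring_scheme" and V :: "('k, 'a, 'm) module_scheme"
    and W :: "('k, 'b, 'n) module_scheme" and U :: "('k, 'c, 'l) module_scheme"
    and b :: "'a \<Rightarrow> 'b \<Rightarrow> 'c" and S :: "('a \<Rightarrow> 'k) \<Rightarrow> 'c \<Rightarrow> 'b"
  assumes K: "field K" and V: "module K V" and W: "module K W" and U: "module K U"
    and bilin: "bilin_map K V W U b"
    and spanning: "carrier U \<subseteq> lin_span K U {b v w | v w. v \<in> carrier V \<and> w \<in> carrier W}"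
    and slice_linear: "lin_map K V (ground_space K) \<phi> \<Longrightarrow> lin_map K U W (S \<phi>)"
    and slice_product: "\<lbrakk>lin_map K V (ground_space K) \<phi>; v \<in> carrier V; w \<in> carrier W\<rbrakk> \<Longrightarrow>
      S \<phi> (b v w) = \<phi> v \<odot>\<^bsub>W\<^esub> w"
begin

text \<open>The abstract form of \<open>tensor_subspace\<close>. In the flipped instance the
  arguments appear in swapped order.\<close>

definition prods :: "'a set \<Rightarrow> 'b set \<Rightarrow> 'c set"
  where "prods A B = lin_span K U {b x y | x y. x \<in> A \<and> y \<in> B}"

lemma prods_gens: "\<lbrakk>A \<subseteq> carrier V; B \<subseteq> carrier W\<rbrakk> \<Longrightarrow> {b x y | x y. x \<in> A \<and> y \<in> B} \<subseteq> carrier U"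
  using bilin_map_closed[OF bilin] by blast

lemma prods_submodule: "\<lbrakk>A \<subseteq> carrier V; B \<subseteq> carrier W\<rbrakk> \<Longrightarrow> submodule (prods A B) K U"
  unfolding prods_def by (rule lin_span_submodule[OF U prods_gens])

lemma prods_intro: "\<lbrakk>x \<in> A; y \<in> B\<rbrakk> \<Longrightarrow> b x y \<in> prods A B"
  unfolding prods_def using lin_span_superset by fastforce

lemma prods_least: "\<lbrakk>submodule N K U; \<And>x y. \<lbrakk>x \<in> A; y \<in> B\<rbrakk> \<Longrightarrow> b x y \<in> N\<rbrakk> \<Longrightarrow> prods A B \<subseteq> N"
  unfolding prods_def by (rule lin_span_least) blast+

lemma prods_mono:
  "\<lbrakk>A \<subseteq> A'; B \<subseteq> B'; A' \<subseteq> carrier V; B' \<subseteq> carrier W\<rbrakk> \<Longrightarrow> prods A B \<subseteq> prods A' B'"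
  by (rule prods_least[OF prods_submodule]) (blast intro: prods_intro)+

text \<open>Finitely many generating products suffice, and choosing the two factors of each gives
  the finite sets.\<close>

lemma prods_finite:
  assumes A: "A \<subseteq> carrier V" and B: "B \<subseteq> carrier W" and X: "X \<in> prods A B"
  shows "\<exists>A' B'. finite A' \<and> A' \<subseteq> A \<and> finite B' \<and> B' \<subseteq> B \<and> X \<in> prods A' B'"
proof -
  obtain T where T: "finite T" "T \<subseteq> {b x y | x y. x \<in> A \<and> y \<in> B}" "X \<in> lin_span K U T"
    using lin_span_finite_subset[OF U prods_gens[OF A B] X[unfolded prods_def]]
    by (elim exE conjE) (rule that)
  then have "\<forall>t\<in>T. \<exists>x y. t = b x y \<and> x \<in> A \<and> y \<in> B" by blast
  then obtain f g where fg: "\<And>t. t \<in> T \<Longrightarrow> t = b (f t) (g t)" "\<And>t. t \<in> T \<Longrightarrow> f t \<in> A"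
    "\<And>t. t \<in> T \<Longrightarrow> g t \<in> B" by metis
  have sub: "submodule (prods (f ` T) (g ` T)) K U" using fg A B by (intro prods_submodule) blast+
  have "t \<in> prods (f ` T) (g ` T)" if "t \<in> T" for t
    using prods_intro[of "f t" "f ` T" "g t" "g ` T"] fg(1)[OF that] that by simp
  then have "X \<in> prods (f ` T) (g ` T)" using lin_span_least[OF sub] T(3) by blast
  moreover have "f ` T \<subseteq> A" "g ` T \<subseteq> B" using fg by blast+
  ultimately show ?thesis using T(1) by blast
qed

text \<open>Linearity in the second argument collects all terms with first factor \<open>x\<close>
  into a single product. This is the inductive step for tensors with finitely many first
  factors.\<close>

lemma prods_insert:
  assumes "x \<in> carrier V" "T \<subseteq> carrier V" and X: "X \<in> prods (insert x T) (carrier W)"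
  shows "\<exists>w\<in>carrier W. \<exists>Y\<in>prods T (carrier W). X = b x w \<oplus>\<^bsub>U\<^esub> Y"
proof -
  interpret U: module K U by (rule U)
  interpret W: module K W by (rule W)
  define N where "N = {b x w \<oplus>\<^bsub>U\<^esub> Y | w Y. w \<in> carrier W \<and> Y \<in> prods T (carrier W)}"
  have I: "b x w \<oplus>\<^bsub>U\<^esub> Y \<in> N" if "w \<in> carrier W" "Y \<in> prods T (carrier W)" for w Y
    unfolding N_def using that by blast
  have E: "\<exists>w\<in>carrier W. \<exists>Y\<in>prods T (carrier W). X = b x w \<oplus>\<^bsub>U\<^esub> Y" if "X \<in> N" for X
    using that unfolding N_def by blast
  have sub: "submodule (prods T (carrier W)) K U" using assms by (intro prods_submodule) simp_all
  note cl = submodule_carrier[OF U sub] and lin = bilin_map_right[OF bilin \<open>x \<in> carrier V\<close>]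
  note bx = lin_map_closed[OF lin] and b0 = lin_map_zero[OF W U lin]
  have "submodule N K U"
    unfolding submodule_iff[OF U]
  proof (intro conjI ballI subsetI)
    fix X assume "X \<in> N"
    then obtain w Y where X: "X = b x w \<oplus>\<^bsub>U\<^esub> Y" "w \<in> carrier W" "Y \<in> prods T (carrier W)"
      using E by metis
    show "X \<in> carrier U" using X cl bx by simp
    have "a \<odot>\<^bsub>U\<^esub> X = b x (a \<odot>\<^bsub>W\<^esub> w) \<oplus>\<^bsub>U\<^esub> (a \<odot>\<^bsub>U\<^esub> Y)" if "a \<in> carrier K" for a
      using X cl bx that by (simp add: lin_map_smult[OF lin] U.smult_r_distr)
    then show "a \<odot>\<^bsub>U\<^esub> X \<in> N" if "a \<in> carrier K" for a
      using I[OF W.smult_closed[OF that X(2)] submodule_smult[OF U sub that X(3)]] that by simp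
    fix X' assume "X' \<in> N"
    then obtain w' Y' where X': "X' = b x w' \<oplus>\<^bsub>U\<^esub> Y'" "w' \<in> carrier W" "Y' \<in> prods T (carrier W)"
      using E by metis
    have "X \<oplus>\<^bsub>U\<^esub> X' = b x (w \<oplus>\<^bsub>W\<^esub> w') \<oplus>\<^bsub>U\<^esub> (Y \<oplus>\<^bsub>U\<^esub> Y')"
      using X X' cl bx by (simp add: lin_map_add[OF lin] U.add.m_ac)
    then show "X \<oplus>\<^bsub>U\<^esub> X' \<in> N"
      using I[OF W.a_closed[OF X(2) X'(2)] submodule_add[OF U sub X(3) X'(3)]] by simp
  next
    show "\<zero>\<^bsub>U\<^esub> \<in> N" using I[OF W.zero_closed submodule_zero[OF U sub]] b0 by simp
  qed
  moreover have "b v w \<in> N" if v: "v \<in> insert x T" and w: "w \<in> carrier W" for v w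
  proof (cases "v = x")
    case True
    then show ?thesis using I[OF w submodule_zero[OF U sub]] bx[OF w] by simp
  next
    case False
    then have "b v w \<in> prods T (carrier W)" using v w by (intro prods_intro) simp_all
    then show ?thesis using I[OF W.zero_closed] cl b0 by (metis U.l_zero)
  qed
  ultimately have "prods (insert x T) (carrier W) \<subseteq> N" by (rule prods_least)
  then show ?thesis using E[OF subsetD[OF _ X]] by simp
qed

text \<open>The easy half of the slice criterion: slicing a product leaves a scalar multiple of its
  second factor.\<close>

lemma slice_prods:
  assumes \<phi>: "lin_map K V (ground_space K) \<phi>" and A: "A \<subseteq> carrier V" and B: "submodule B K W"
    and X: "X \<in> prods A B"
  shows "S \<phi> X \<in> B"
proof -
  have "prods A B \<subseteq> {X \<in> carrier U. S \<phi> X \<in> B}"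
  proof (rule prods_least[OF lin_map_vimage[OF U W slice_linear[OF \<phi>] B]])
    fix x y assume xy: "x \<in> A" "y \<in> B"
    then have c: "x \<in> carrier V" "y \<in> carrier W" using A submodule_carrier[OF W B] by blast+
    then have "\<phi> x \<in> carrier K" using lin_map_closed[OF \<phi>] by (simp add: ground_space_simps)
    then show "b x y \<in> {X \<in> carrier U. S \<phi> X \<in> B}"
      using slice_product[OF \<phi> c] bilin_map_closed[OF bilin c] submodule_smult[OF W B] xy by simp
  qed
  then show ?thesis using X by blast
qed

text \<open>Induction on the number of first factors: a first factor in the span of the others is
  eliminated; otherwise a functional that is \<open>1\<close> on it and \<open>0\<close> on the others shows that the matching
  second factor is a slice of \<open>X\<close>.\<close>

lemma slices_in_imp_prods:
  assumes A: "submodule A K V" and B: "submodule B K W"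
    and X: "X \<in> prods A (carrier W)"
    and slices: "\<And>\<phi>. lin_map K V (ground_space K) \<phi> \<Longrightarrow> S \<phi> X \<in> B"
  shows "X \<in> prods A B"
proof -
  interpret U: module K U by (rule U)
  interpret W: module K W by (rule W)
  have Ac: "A \<subseteq> carrier V" and Bc: "B \<subseteq> carrier W"
    using submodule_carrier[OF V A] submodule_carrier[OF W B] by blast+
  note sub = prods_submodule[OF Ac Bc]
  have "X \<in> prods A B" if "finite T" "T \<subseteq> A" "X \<in> prods T (carrier W)"
    "\<And>\<phi>. lin_map K V (ground_space K) \<phi> \<Longrightarrow> S \<phi> X \<in> B" for T X
    using that
  proof (induction T arbitrary: X rule: finite_induct)
    case empty
    have "prods {} (carrier W) \<subseteq> prods A B" by (rule prods_least[OF sub]) simp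
    then show ?case using empty by blast
  next
    case (insert x T)
    have x: "x \<in> carrier V" "x \<in> A" and T: "T \<subseteq> carrier V" "T \<subseteq> A" using insert.prems(1) Ac by auto
    have subT: "submodule (prods T (carrier W)) K U" using T by (intro prods_submodule) auto
    obtain w Y where XY: "X = b x w \<oplus>\<^bsub>U\<^esub> Y" "w \<in> carrier W" "Y \<in> prods T (carrier W)"
      using prods_insert[OF x(1) T(1) insert.prems(2)] by blast
    have Y: "Y \<in> carrier U" using submodule_carrier[OF U subT XY(3)] .
    show ?case
    proof (cases "x \<in> lin_span K V T")
      case True
      have "lin_span K V T \<subseteq> {v \<in> carrier V. b v w \<in> prods T (carrier W)}"
        using T XY(2)
        by (intro lin_span_least lin_map_vimage[OF V U bilin_map_left[OF bilin] subT])
          (blast intro: prods_intro)+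
      then have "X \<in> prods T (carrier W)" using True XY submodule_add[OF U subT] by blast
      then show ?thesis using insert.IH[OF T(2)] insert.prems(3) by blast
    next
      case False
      then obtain \<phi> where \<phi>: "lin_map K V (ground_space K) \<phi>" "\<phi> x = \<one>\<^bsub>K\<^esub>"
        "\<And>v. v \<in> lin_span K V T \<Longrightarrow> \<phi> v = \<zero>\<^bsub>K\<^esub>"
        using separating_functional[OF K V lin_span_submodule[OF V T(1)] x(1)] by blast
      have bxw: "b x w \<in> carrier U" by (rule bilin_map_closed[OF bilin x(1) XY(2)])
      have split: "S \<psi> X = \<psi> x \<odot>\<^bsub>W\<^esub> w \<oplus>\<^bsub>W\<^esub> S \<psi> Y" if "lin_map K V (ground_space K) \<psi>" for \<psi>
        using XY(1) lin_map_add[OF slice_linear[OF that] bxw Y] slice_product[OF that x(1) XY(2)] by simp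
      have "prods T (carrier W) \<subseteq> {X \<in> carrier U. S \<phi> X = \<zero>\<^bsub>W\<^esub>}"
      proof (rule prods_least[OF lin_map_eq_submodule[OF U W slice_linear[OF \<phi>(1)] lin_map_zero_map[OF W]]])
        fix v y assume v: "v \<in> T" and y: "y \<in> carrier W"
        have vc: "v \<in> carrier V" by (rule subsetD[OF T(1) v])
        have "\<phi> v = \<zero>\<^bsub>K\<^esub>" by (rule \<phi>(3)[OF subsetD[OF lin_span_superset v]])
        then show "b v y \<in> {X \<in> carrier U. S \<phi> X = \<zero>\<^bsub>W\<^esub>}"
          using slice_product[OF \<phi>(1) vc y] bilin_map_closed[OF bilin vc y] y by simp
      qed
      then have "S \<phi> Y = \<zero>\<^bsub>W\<^esub>" by (auto dest: subsetD[OF _ XY(3)])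
      then have "S \<phi> X = w" using split[OF \<phi>(1)] \<phi>(2) XY(2) by simp
      then have w: "w \<in> B" using insert.prems(3)[OF \<phi>(1)] by simp
      \<comment> \<open>Now that \<open>w\<close> is known to lie in \<open>B\<close>, subtracting
        its multiple passes the hypothesis on slices from \<open>X\<close> to the remainder
        \<open>Y\<close>, as the induction hypothesis requires.\<close>
      have "S \<psi> Y \<in> B" if \<psi>: "lin_map K V (ground_space K) \<psi>" for \<psi>
      proof -
        have c: "\<psi> x \<in> carrier K" using lin_map_closed[OF \<psi> x(1)] by (simp add: ground_space_simps)
        then have "\<psi> x \<odot>\<^bsub>W\<^esub> w \<in> B" using submodule_smult[OF W B _ w] by blast
        then have "S \<psi> X \<ominus>\<^bsub>W\<^esub> \<psi> x \<odot>\<^bsub>W\<^esub> w \<in> B"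
          using insert.prems(3)[OF \<psi>] submodule_minus[OF W B] by blast
        also have "S \<psi> X \<ominus>\<^bsub>W\<^esub> \<psi> x \<odot>\<^bsub>W\<^esub> w = S \<psi> Y"
          using c XY(2) lin_map_closed[OF slice_linear[OF \<psi>] Y]
          by (simp add: split[OF \<psi>] W.minus_eq W.add.m_ac W.r_neg1 W.r_neg2 W.r_neg)
        finally show ?thesis .
      qed
      then have "Y \<in> prods A B" using insert.IH[OF T(2) XY(3)] by blast
      then show ?thesis using XY(1) w x(2) prods_intro submodule_add[OF U sub] by blast
    qed
  qed
  moreover obtain T T' where T: "finite T" "T \<subseteq> A" "T' \<subseteq> carrier W" "X \<in> prods T T'"
    using prods_finite[OF Ac order.refl X] by blast
  then have "X \<in> prods T (carrier W)" using prods_mono[of T T T'] Ac by blast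
  ultimately show ?thesis using T slices by blast
qed

lemma carrier_prods: "carrier U \<subseteq> prods (carrier V) (carrier W)"
  unfolding prods_def by (rule spanning)

text \<open>Any finite expression of \<open>X\<close> bounds the slices by a finitely generated
  space, but a generating set of their span itself is wanted. The slice criterion supplies it:
  \<open>X\<close> can be written with second factors taken from the span \<open>L\<close> of its
  own slices. The finitely many used, \<open>T\<close>, lie in \<open>L\<close>, and conversely
  every slice lies in their span.\<close>

lemma finite_slices:
  assumes X: "X \<in> carrier U"
  shows "\<exists>T. finite T \<and> T \<subseteq> carrier W \<and>
    lin_span K W {S \<phi> X | \<phi>. lin_map K V (ground_space K) \<phi>} = lin_span K W T"
proof -
  interpret V: module K V by (rule V)
  interpret W: module K W by (rule W)
  define L where "L = lin_span K W {S \<phi> X | \<phi>. lin_map K V (ground_space K) \<phi>}"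
  have Lc: "{S \<phi> X | \<phi>. lin_map K V (ground_space K) \<phi>} \<subseteq> carrier W"
    using lin_map_closed[OF slice_linear X] by blast
  have L: "submodule L K W" unfolding L_def by (rule lin_span_submodule[OF W Lc])
  have Lsub: "L \<subseteq> carrier W" using submodule_carrier[OF W L] by blast
  have XL: "X \<in> prods (carrier V) L"
  proof (rule slices_in_imp_prods[OF V.carrier_is_submodule L])
    show "X \<in> prods (carrier V) (carrier W)" using carrier_prods X by blast
    show "S \<phi> X \<in> L" if "lin_map K V (ground_space K) \<phi>" for \<phi>
      unfolding L_def by (rule subsetD[OF lin_span_superset]) (use that in blast)
  qed
  obtain A T where AT: "A \<subseteq> carrier V" and T: "finite T" "T \<subseteq> L" and X_AT: "X \<in> prods A T"
    using prods_finite[OF order.refl Lsub XL] by (elim exE conjE) (rule that)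
  have Tc: "T \<subseteq> carrier W" using T(2) Lsub by blast
  note Tsub = lin_span_submodule[OF W Tc]
  have Tsc: "lin_span K W T \<subseteq> carrier W" using submodule_carrier[OF W Tsub] by blast
  have XT: "X \<in> prods (carrier V) (lin_span K W T)"
    using X_AT prods_mono[OF AT lin_span_superset order.refl Tsc] by blast
  have "S \<phi> X \<in> lin_span K W T" if "lin_map K V (ground_space K) \<phi>" for \<phi>
    by (rule slice_prods[OF that order.refl Tsub XT])
  then have "L \<subseteq> lin_span K W T" unfolding L_def by (intro lin_span_least[OF Tsub]) blast
  moreover have "lin_span K W T \<subseteq> L" by (rule lin_span_least[OF L T(2)])
  ultimately show ?thesis using T(1) Tc unfolding L_def by (intro exI[of _ T] conjI equalityI)
qed

end

section \<open>Closing a subspace under slices\<close>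

context slicing
begin

text \<open>A single round of slicing. For a counital and coassociative \<open>\<delta>\<close> the
  result already contains \<open>E\<close> and is stable under further slicing; neither is assumed
  here.\<close>

definition hull :: "('b \<Rightarrow> 'c) \<Rightarrow> 'b set \<Rightarrow> 'b set"
  where "hull \<delta> E = lin_span K W {S \<phi> (\<delta> x) | \<phi> x. lin_map K V (ground_space K) \<phi> \<and> x \<in> E}"

context
  fixes \<delta> :: "'b \<Rightarrow> 'c"
  assumes \<delta>: "lin_map K W U \<delta>"
begin

lemma hull_gens:
  "E \<subseteq> carrier W \<Longrightarrow> {S \<phi> (\<delta> x) | \<phi> x. lin_map K V (ground_space K) \<phi> \<and> x \<in> E} \<subseteq> carrier W"
  using lin_map_closed[OF slice_linear lin_map_closed[OF \<delta>]] by blast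

lemma hull_submodule: "E \<subseteq> carrier W \<Longrightarrow> submodule (hull \<delta> E) K W"
  unfolding hull_def by (rule lin_span_submodule[OF W hull_gens])

lemma hull_intro: "\<lbrakk>lin_map K V (ground_space K) \<phi>; x \<in> E\<rbrakk> \<Longrightarrow> S \<phi> (\<delta> x) \<in> hull \<delta> E"
  unfolding hull_def by (rule subsetD[OF lin_span_superset]) blast

lemma hull_least:
  "\<lbrakk>submodule N K W; \<And>\<phi> x. \<lbrakk>lin_map K V (ground_space K) \<phi>; x \<in> E\<rbrakk> \<Longrightarrow> S \<phi> (\<delta> x) \<in> N\<rbrakk>
    \<Longrightarrow> hull \<delta> E \<subseteq> N"
  unfolding hull_def by (rule lin_span_least) blast+

text \<open>The way to prove something about a whole hull. The map \<open>f\<close> is later either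
  another slice of a comultiplication or coaction, for stability, or the comultiplication
  itself.\<close>

lemma hull_map:
  assumes Y: "module K Y" and f: "lin_map K W Y f" and N: "submodule N K Y" and E: "E \<subseteq> carrier W"
    and gens: "\<And>\<phi> x. \<lbrakk>lin_map K V (ground_space K) \<phi>; x \<in> E\<rbrakk> \<Longrightarrow> f (S \<phi> (\<delta> x)) \<in> N"
    and x: "x \<in> hull \<delta> E"
  shows "f x \<in> N"
proof -
  have "hull \<delta> E \<subseteq> {x \<in> carrier W. f x \<in> N}"
    by (rule hull_least[OF lin_map_vimage[OF W Y f N]])
      (use gens hull_gens[OF E] in blast)
  then show ?thesis using x by blast
qed

text \<open>Slices of \<open>\<delta> x\<close> are linear in \<open>x\<close>, so finitely many
  generators of \<open>E\<close> suffice, each contributing the finite set from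
  \<open>finite_slices\<close>. Since these sets lie in the spans of actual slices, their union
  spans exactly the hull.\<close>

lemma hull_finite_dim:
  assumes E: "finite_dim_subspace K W E"
  shows "finite_dim_subspace K W (hull \<delta> E)"
proof -
  obtain G where G: "finite G" "G \<subseteq> carrier W" "E = lin_span K W G"
    using E unfolding finite_dim_subspace_def by blast
  have GE: "G \<subseteq> E" unfolding G(3) by (rule lin_span_superset)
  have Ec: "E \<subseteq> carrier W"
    using E submodule_carrier[OF W] unfolding finite_dim_subspace_def by blast
  define L where "L g = {S \<phi> (\<delta> g) | \<phi>. lin_map K V (ground_space K) \<phi>}" for g
  have "\<forall>g\<in>G. \<exists>T. finite T \<and> T \<subseteq> carrier W \<and> lin_span K W (L g) = lin_span K W T"
    unfolding L_def using finite_slices[OF lin_map_closed[OF \<delta>]] G(2) by blast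
  then obtain T where T: "\<And>g. g \<in> G \<Longrightarrow> finite (T g)" "\<And>g. g \<in> G \<Longrightarrow> T g \<subseteq> carrier W"
    "\<And>g. g \<in> G \<Longrightarrow> lin_span K W (L g) = lin_span K W (T g)" by metis
  let ?T = "\<Union> (T ` G)"
  have Tc: "?T \<subseteq> carrier W" using T(2) by blast
  note Tsub = lin_span_submodule[OF W Tc]
  have "E \<subseteq> {x \<in> carrier W. S \<phi> (\<delta> x) \<in> lin_span K W ?T}"
    if \<phi>: "lin_map K V (ground_space K) \<phi>" for \<phi>
    unfolding G(3)
  proof (rule lin_span_least[OF lin_map_vimage[OF W W lin_map_comp[OF \<delta> slice_linear[OF \<phi>]] Tsub]])
    show "G \<subseteq> {x \<in> carrier W. S \<phi> (\<delta> x) \<in> lin_span K W ?T}"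
    proof
      fix g assume g: "g \<in> G"
      have "S \<phi> (\<delta> g) \<in> L g" unfolding L_def using \<phi> by blast
      then have "S \<phi> (\<delta> g) \<in> lin_span K W (T g)"
        unfolding T(3)[OF g, symmetric] by (rule subsetD[OF lin_span_superset])
      moreover have "T g \<subseteq> ?T" using g by blast
      ultimately have "S \<phi> (\<delta> g) \<in> lin_span K W ?T" using lin_span_mono[OF W _ Tc] by blast
      then show "g \<in> {x \<in> carrier W. S \<phi> (\<delta> x) \<in> lin_span K W ?T}" using g G(2) by blast
    qed
  qed
  then have "hull \<delta> E \<subseteq> lin_span K W ?T" by (intro hull_least[OF Tsub]) blast
  moreover have "lin_span K W ?T \<subseteq> hull \<delta> E"
  proof (rule lin_span_least[OF hull_submodule[OF Ec]])
    show "?T \<subseteq> hull \<delta> E"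
    proof
      fix t assume "t \<in> ?T"
      then obtain g where g: "g \<in> G" "t \<in> T g" by blast
      have "t \<in> lin_span K W (L g)"
        unfolding T(3)[OF g(1)] by (rule subsetD[OF lin_span_superset g(2)])
      moreover have "lin_span K W (L g) \<subseteq> hull \<delta> E"
        unfolding L_def by (rule lin_span_least[OF hull_submodule[OF Ec]]) (use hull_intro g(1) GE in blast)
      ultimately show "t \<in> hull \<delta> E" by blast
    qed
  qed
  ultimately show ?thesis unfolding finite_dim_subspace_def
    using hull_submodule[OF Ec] Tc T(1) G(1) by (intro conjI exI[of _ ?T] equalityI) simp_all
qed

end

end

section \<open>Slices by functionals on either leg of a tensor product\<close>

definition left_slice ::
  "('k, 'r) ring_scheme \<Rightarrow> ('k, 'a, 'm) module_scheme \<Rightarrow> ('k, 'b, 'n) module_scheme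
    \<Rightarrow> ('a \<Rightarrow> 'k) \<Rightarrow> ('a \<times> 'b \<Rightarrow> 'k) set \<Rightarrow> 'b"
  where "left_slice K V W \<phi> = tensor_lift K V W W (\<lambda>v w. \<phi> v \<odot>\<^bsub>W\<^esub> w)"

text \<open>The map id \<otimes> \<psi> followed by the identification of V \<otimes> K with V;
  \<open>left_slice\<close> is its mirror image.\<close>

definition right_slice ::
  "('k, 'r) ring_scheme \<Rightarrow> ('k, 'a, 'm) module_scheme \<Rightarrow> ('k, 'b, 'n) module_scheme
    \<Rightarrow> ('b \<Rightarrow> 'k) \<Rightarrow> ('a \<times> 'b \<Rightarrow> 'k) set \<Rightarrow> 'a"
  where "right_slice K V W \<psi> = tensor_lift K V W V (\<lambda>v w. \<psi> w \<odot>\<^bsub>V\<^esub> v)"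

context
  fixes K :: "('k, 'r) ring_scheme" and V :: "('k, 'a, 'm) module_scheme"
    and W :: "('k, 'b, 'n) module_scheme"
  assumes V: "module K V" and W: "module K W"
begin

lemma left_slice_linear:
  "lin_map K V (ground_space K) \<phi> \<Longrightarrow> lin_map K (tensor_space K V W) W (left_slice K V W \<phi>)"
  unfolding left_slice_def by (rule tensor_lift_linear[OF V W W bilin_map_functional_smult[OF W]])

lemma left_slice_pure:
  "\<lbrakk>lin_map K V (ground_space K) \<phi>; v \<in> carrier V; w \<in> carrier W\<rbrakk> \<Longrightarrow>
    left_slice K V W \<phi> (pure_tensor K V W v w) = \<phi> v \<odot>\<^bsub>W\<^esub> w"
  unfolding left_slice_def by (rule tensor_lift_pure[OF V W W bilin_map_functional_smult[OF W]])

lemma right_slice_linear: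
  "lin_map K W (ground_space K) \<psi> \<Longrightarrow> lin_map K (tensor_space K V W) V (right_slice K V W \<psi>)"
  unfolding right_slice_def
  by (rule tensor_lift_linear[OF V W V bilin_map_flip[OF bilin_map_functional_smult[OF V]]])

lemma right_slice_pure:
  "\<lbrakk>lin_map K W (ground_space K) \<psi>; v \<in> carrier V; w \<in> carrier W\<rbrakk> \<Longrightarrow>
    right_slice K V W \<psi> (pure_tensor K V W v w) = \<psi> w \<odot>\<^bsub>V\<^esub> v"
  unfolding right_slice_def
  by (rule tensor_lift_pure[OF V W V bilin_map_flip[OF bilin_map_functional_smult[OF V]]])

lemma tensor_subspace_gens:
  "\<lbrakk>A \<subseteq> carrier V; B \<subseteq> carrier W\<rbrakk> \<Longrightarrow>
    {pure_tensor K V W a b | a b. a \<in> A \<and> b \<in> B} \<subseteq> carrier (tensor_space K V W)"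
  using pure_tensor_closed[OF V W] by blast

lemma tensor_subspace_submodule:
  "\<lbrakk>A \<subseteq> carrier V; B \<subseteq> carrier W\<rbrakk> \<Longrightarrow>
    submodule (tensor_subspace K V W A B) K (tensor_space K V W)"
  unfolding tensor_subspace_def
  by (rule lin_span_submodule[OF module_tensor_space[OF V W] tensor_subspace_gens])

lemma tensor_subspace_intro:
  "\<lbrakk>a \<in> A; b \<in> B\<rbrakk> \<Longrightarrow> pure_tensor K V W a b \<in> tensor_subspace K V W A B"
  unfolding tensor_subspace_def by (rule subsetD[OF lin_span_superset]) blast

lemma tensor_subspace_map:
  assumes Y: "module K Y" and f: "lin_map K (tensor_space K V W) Y f" and N: "submodule N K Y"
    and A: "A \<subseteq> carrier V" and B: "B \<subseteq> carrier W"
    and gens: "\<And>a b. \<lbrakk>a \<in> A; b \<in> B\<rbrakk> \<Longrightarrow> f (pure_tensor K V W a b) \<in> N"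
    and X: "X \<in> tensor_subspace K V W A B"
  shows "f X \<in> N"
proof -
  have "tensor_subspace K V W A B \<subseteq> {X \<in> carrier (tensor_space K V W). f X \<in> N}"
    unfolding tensor_subspace_def
    by (rule lin_span_least[OF lin_map_vimage[OF module_tensor_space[OF V W] Y f N]])
      (use gens tensor_subspace_gens[OF A B] in blast)
  then show ?thesis using X by blast
qed

lemma tensor_space_spanned: "carrier (tensor_space K V W) \<subseteq> tensor_subspace K V W (carrier V) (carrier W)"
  by (rule subsetI,
      rule tensor_space_in_submodule[OF V W tensor_subspace_submodule[OF order.refl order.refl] tensor_subspace_intro])

lemma slicing_left:
  assumes K: "field K"
  shows "slicing K V W (tensor_space K V W) (pure_tensor K V W) (left_slice K V W)"
  by (rule slicing.intro[OF K V W module_tensor_space[OF V W] bilin_map_pure_tensor[OF V W]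
        tensor_space_spanned[unfolded tensor_subspace_def] left_slice_linear left_slice_pure])

lemma flip_gens:
  "{pure_tensor K V W v w | w v. w \<in> B \<and> v \<in> A} = {pure_tensor K V W a b | a b. a \<in> A \<and> b \<in> B}"
  by blast

lemma slicing_right:
  assumes K: "field K"
  shows "slicing K W V (tensor_space K V W) (\<lambda>w v. pure_tensor K V W v w) (right_slice K V W)"
  by (rule slicing.intro[OF K W V module_tensor_space[OF V W] bilin_map_flip[OF bilin_map_pure_tensor[OF V W]]
        tensor_space_spanned[unfolded tensor_subspace_def, folded flip_gens] right_slice_linear right_slice_pure])

text \<open>The first leg is required to lie in \<open>A\<close> already, so that the two criteria
  can be chained: right slices place a tensor in A \<otimes> W, and left slices then narrow the
  second leg.\<close>

lemma tensor_subspace_if_left_slices: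
  assumes K: "field K" and A: "submodule A K V" and B: "submodule B K W"
    and X: "X \<in> tensor_subspace K V W A (carrier W)"
    and slices: "\<And>\<phi>. lin_map K V (ground_space K) \<phi> \<Longrightarrow> left_slice K V W \<phi> X \<in> B"
  shows "X \<in> tensor_subspace K V W A B"
proof -
  interpret L: slicing K V W "tensor_space K V W" "pure_tensor K V W" "left_slice K V W"
    by (rule slicing_left[OF K])
  show ?thesis
    using L.slices_in_imp_prods[OF A B _ slices] X unfolding L.prods_def tensor_subspace_def by simp
qed

lemma tensor_subspace_if_right_slices:
  assumes K: "field K" and A: "submodule A K V"
    and X: "X \<in> carrier (tensor_space K V W)"
    and slices: "\<And>\<psi>. lin_map K W (ground_space K) \<psi> \<Longrightarrow> right_slice K V W \<psi> X \<in> A"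
  shows "X \<in> tensor_subspace K V W A (carrier W)"
proof -
  interpret R: slicing K W V "tensor_space K V W" "\<lambda>w v. pure_tensor K V W v w" "right_slice K V W"
    by (rule slicing_right[OF K])
  have "X \<in> R.prods (carrier W) A"
    by (rule R.slices_in_imp_prods[OF module.carrier_is_submodule[OF W] A subsetD[OF R.carrier_prods X] slices])
  then show ?thesis unfolding R.prods_def tensor_subspace_def flip_gens .
qed

end

section \<open>Trilinear maps and coassociativity\<close>

lemma lin_map_id': "lin_map K V V id"
  unfolding id_def by (rule lin_map_id)

context
  fixes K :: "('k, 'r) ring_scheme" and U :: "('k, 'a, 'm) module_scheme"
    and V :: "('k, 'b, 'n) module_scheme" and W :: "('k, 'c, 'o) module_scheme"
  assumes U: "module K U" and V: "module K V" and W: "module K W"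
begin

context
  fixes M :: "('k, 'd, 'l) module_scheme" and t :: "'a \<Rightarrow> 'b \<Rightarrow> 'c \<Rightarrow> 'd"
  assumes M: "module K M"
    and t1: "\<And>w. w \<in> carrier W \<Longrightarrow> bilin_map K U V M (\<lambda>u v. t u v w)"
    and t2: "\<And>u. u \<in> carrier U \<Longrightarrow> bilin_map K V W M (t u)"
begin

text \<open>The assumptions \<open>t1\<close> and \<open>t2\<close> together express trilinearity of
  \<open>t\<close>. They are the two ingredients for lifting it along either bracketing of the
  triple tensor product.\<close>

lemma trilin_lift_right: "bilin_map K U (tensor_space K V W) M (\<lambda>u. tensor_lift K V W M (t u))"
  by (rule bilin_map_tensor_lift[OF V W M U t2 bilin_map_left[OF t1]])

lemma trilin_lift_left: "bilin_map K (tensor_space K U V) W M (\<lambda>X w. tensor_lift K U V M (\<lambda>u v. t u v w) X)"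
  by (rule bilin_map_flip[OF bilin_map_tensor_lift[OF U V M W t1 bilin_map_right[OF t2]]])

end

lemma
  shows trilin_pure1: "w \<in> carrier W \<Longrightarrow> bilin_map K U V (tensor_space K U (tensor_space K V W))
      (\<lambda>u v. pure_tensor K U (tensor_space K V W) u (pure_tensor K V W v w))"
    and trilin_pure2: "u \<in> carrier U \<Longrightarrow> bilin_map K V W (tensor_space K U (tensor_space K V W))
      (\<lambda>v w. pure_tensor K U (tensor_space K V W) u (pure_tensor K V W v w))"
proof -
  note VW = module_tensor_space[OF V W] bilin_map_pure_tensor[OF V W]
  note UVW = bilin_map_pure_tensor[OF U VW(1)]
  show "w \<in> carrier W \<Longrightarrow> bilin_map K U V (tensor_space K U (tensor_space K V W))
      (\<lambda>u v. pure_tensor K U (tensor_space K V W) u (pure_tensor K V W v w))"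
    by (rule bilin_map_precomp[OF UVW lin_map_id bilin_map_left[OF VW(2)]])
  show "u \<in> carrier U \<Longrightarrow> bilin_map K V W (tensor_space K U (tensor_space K V W))
      (\<lambda>v w. pure_tensor K U (tensor_space K V W) u (pure_tensor K V W v w))"
    by (rule bilin_map_comp[OF VW(2) bilin_map_right[OF UVW]])
qed

lemma tensor_assoc_linear:
  "lin_map K (tensor_space K (tensor_space K U V) W) (tensor_space K U (tensor_space K V W)) (tensor_assoc K U V W)"
  unfolding tensor_assoc_def Let_def
  by (rule tensor_lift_linear[OF module_tensor_space[OF U V] W module_tensor_space[OF U module_tensor_space[OF V W]]
    trilin_lift_left[OF module_tensor_space[OF U module_tensor_space[OF V W]] trilin_pure1 trilin_pure2]])

lemma tensor_assoc_pure:
  "\<lbrakk>X \<in> carrier (tensor_space K U V); w \<in> carrier W\<rbrakk> \<Longrightarrow>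
    tensor_assoc K U V W (pure_tensor K (tensor_space K U V) W X w) =
    tensor_lift K U V (tensor_space K U (tensor_space K V W))
      (\<lambda>u v. pure_tensor K U (tensor_space K V W) u (pure_tensor K V W v w)) X"
  unfolding tensor_assoc_def Let_def
  by (rule tensor_lift_pure[OF module_tensor_space[OF U V] W module_tensor_space[OF U module_tensor_space[OF V W]]
    trilin_lift_left[OF module_tensor_space[OF U module_tensor_space[OF V W]] trilin_pure1 trilin_pure2]])

context
  fixes M :: "('k, 'd, 'l) module_scheme" and t :: "'a \<Rightarrow> 'b \<Rightarrow> 'c \<Rightarrow> 'd"
  assumes M: "module K M"
    and t1: "\<And>w. w \<in> carrier W \<Longrightarrow> bilin_map K U V M (\<lambda>u v. t u v w)"
    and t2: "\<And>u. u \<in> carrier U \<Longrightarrow> bilin_map K V W M (t u)"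
begin

text \<open>Both sides reduce to \<open>t u v w\<close> on pure tensors. The reduction is done
  twice, since the left leg of a pure tensor over U \<otimes> V is itself an arbitrary
  tensor.\<close>

lemma tensor_lift_assoc:
  assumes Z: "Z \<in> carrier (tensor_space K (tensor_space K U V) W)"
  shows "tensor_lift K U (tensor_space K V W) M (\<lambda>u. tensor_lift K V W M (t u)) (tensor_assoc K U V W Z) =
    tensor_lift K (tensor_space K U V) W M (\<lambda>X w. tensor_lift K U V M (\<lambda>u v. t u v w) X) Z"
proof -
  note UV = module_tensor_space[OF U V] and VW = module_tensor_space[OF V W]
  note UVW = module_tensor_space[OF U VW]
  have tr: "bilin_map K U (tensor_space K V W) M (\<lambda>u. tensor_lift K V W M (t u))"
    by (rule trilin_lift_right[OF M t1 t2])
  have tl: "bilin_map K (tensor_space K U V) W M (\<lambda>X w. tensor_lift K U V M (\<lambda>u v. t u v w) X)"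
    by (rule trilin_lift_left[OF M t1 t2])
  note lin = tensor_lift_linear[OF U VW M tr]
  note p1 = trilin_pure1 and pure = tensor_lift_pure[OF U VW M tr]
  show ?thesis
  proof (rule tensor_lift_eqI[OF UV W M tl lin_map_comp[OF tensor_assoc_linear lin] _ Z, symmetric])
    fix X w assume X: "X \<in> carrier (tensor_space K U V)" and w: "w \<in> carrier W"
    show "tensor_lift K U (tensor_space K V W) M (\<lambda>u. tensor_lift K V W M (t u))
        (tensor_assoc K U V W (pure_tensor K (tensor_space K U V) W X w)) =
      tensor_lift K U V M (\<lambda>u v. t u v w) X"
      unfolding tensor_assoc_pure[OF X w]
    proof (rule tensor_lift_eqI[OF U V M t1[OF w]
          lin_map_comp[OF tensor_lift_linear[OF U V UVW p1[OF w]] lin] _ X, symmetric])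
      fix u v assume u: "u \<in> carrier U" and v: "v \<in> carrier V"
      show "tensor_lift K U (tensor_space K V W) M (\<lambda>u. tensor_lift K V W M (t u))
        (tensor_lift K U V (tensor_space K U (tensor_space K V W))
          (\<lambda>u v. pure_tensor K U (tensor_space K V W) u (pure_tensor K V W v w)) (pure_tensor K U V u v)) = t u v w"
        by (simp add: tensor_lift_pure[OF U V UVW p1[OF w] u v] pure[OF u pure_tensor_closed[OF V W v w]]
            tensor_lift_pure[OF V W M t2[OF u] v w])
    qed
  qed
qed

text \<open>Coassociativity in usable form: any trilinear expression may be evaluated by splitting
  either leg. Separate spaces \<open>P\<close> and \<open>Q\<close> let one statement serve
  coalgebras (\<open>P = Q = C\<close>) and comodules (\<open>P = C\<close>,
  \<open>Q = H\<close>).\<close>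

lemma coassoc_tensor_lift:
  assumes P: "module K P" and Q: "module K Q"
    and f: "lin_map K P (tensor_space K U V) f" and g: "lin_map K Q (tensor_space K V W) g"
    and X: "X \<in> carrier (tensor_space K P W)" and Y: "Y \<in> carrier (tensor_space K U Q)"
    and eq: "tensor_assoc K U V W (tensor_map K P W (tensor_space K U V) W f id X) =
      tensor_map K U Q U (tensor_space K V W) id g Y"
  shows "tensor_lift K U Q M (\<lambda>u q. tensor_lift K V W M (t u) (g q)) Y =
    tensor_lift K P W M (\<lambda>p w. tensor_lift K U V M (\<lambda>u v. t u v w) (f p)) X"
proof -
  note UV = module_tensor_space[OF U V] and VW = module_tensor_space[OF V W]
  have tr: "bilin_map K U (tensor_space K V W) M (\<lambda>u. tensor_lift K V W M (t u))"
    by (rule trilin_lift_right[OF M t1 t2])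
  have tl: "bilin_map K (tensor_space K U V) W M (\<lambda>X w. tensor_lift K U V M (\<lambda>u v. t u v w) X)"
    by (rule trilin_lift_left[OF M t1 t2])
  have "tensor_lift K U Q M (\<lambda>u q. tensor_lift K V W M (t u) (g q)) Y =
    tensor_lift K U (tensor_space K V W) M (\<lambda>u. tensor_lift K V W M (t u))
      (tensor_map K U Q U (tensor_space K V W) id g Y)"
    using tensor_lift_tensor_map[OF U Q U VW lin_map_id' g M tr Y] by simp
  also have "\<dots> = tensor_lift K (tensor_space K U V) W M (\<lambda>X w. tensor_lift K U V M (\<lambda>u v. t u v w) X)
      (tensor_map K P W (tensor_space K U V) W f id X)"
    unfolding eq[symmetric]
    by (rule tensor_lift_assoc[OF lin_map_closed[OF tensor_map_linear[OF P W UV W f lin_map_id'] X]])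
  also have "\<dots> = tensor_lift K P W M (\<lambda>p w. tensor_lift K U V M (\<lambda>u v. t u v w) (f p)) X"
    using tensor_lift_tensor_map[OF P W UV W f lin_map_id' M tl X] by simp
  finally show ?thesis .
qed

end

end

section \<open>Convolution and composition of slices\<close>

lemma bilin_map_functional_mult:
  assumes K: "cring K" and \<phi>: "lin_map K V (ground_space K) \<phi>" and \<psi>: "lin_map K W (ground_space K) \<psi>"
  shows "bilin_map K V W (ground_space K) (\<lambda>v w. \<phi> v \<otimes>\<^bsub>K\<^esub> \<psi> w)"
  using bilin_map_precomp[OF bilin_map_smult[OF module_ground_space[OF K]] \<phi> \<psi>]
  by (simp add: ground_space_simps)

lemma functional_mult_right:
  assumes K: "cring K" and \<phi>: "lin_map K V (ground_space K) \<phi>" and a: "a \<in> carrier K"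
  shows "lin_map K V (ground_space K) (\<lambda>v. \<phi> v \<otimes>\<^bsub>K\<^esub> a)"
proof -
  interpret K: cring K by fact
  show ?thesis
    using lin_map_closed[OF \<phi>] lin_map_add[OF \<phi>] lin_map_smult[OF \<phi>] a
    by (intro lin_mapI) (simp_all add: ground_space_simps K.l_distr K.m_assoc)
qed

lemma functional_mult_left:
  assumes K: "cring K" and \<phi>: "lin_map K V (ground_space K) \<phi>" and a: "a \<in> carrier K"
  shows "lin_map K V (ground_space K) (\<lambda>v. a \<otimes>\<^bsub>K\<^esub> \<phi> v)"
  using lin_map_scale[OF module_ground_space[OF K] \<phi> a] by (simp add: ground_space_simps)

lemma functional_closed:
  "\<lbrakk>lin_map K V (ground_space K) \<phi>; v \<in> carrier V\<rbrakk> \<Longrightarrow> \<phi> v \<in> carrier K"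
  using lin_map_closed by (fastforce simp: ground_space_simps)

definition convolution ::
  "('k, 'r) ring_scheme \<Rightarrow> ('k, 'h, 'l) module_scheme \<Rightarrow> ('h \<Rightarrow> ('h \<times> 'h \<Rightarrow> 'k) set)
    \<Rightarrow> ('h \<Rightarrow> 'k) \<Rightarrow> ('h \<Rightarrow> 'k) \<Rightarrow> 'h \<Rightarrow> 'k"
  where "convolution K H \<Delta> \<phi> \<psi> h = tensor_lift K H H (ground_space K) (\<lambda>a b. \<phi> a \<otimes>\<^bsub>K\<^esub> \<psi> b) (\<Delta> h)"

lemma convolution_linear:
  assumes H: "module K H" and \<Delta>: "lin_map K H (tensor_space K H H) \<Delta>"
    and \<phi>: "lin_map K H (ground_space K) \<phi>" and \<psi>: "lin_map K H (ground_space K) \<psi>"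
  shows "lin_map K H (ground_space K) (convolution K H \<Delta> \<phi> \<psi>)"
proof -
  have K: "cring K" using H by (rule module.axioms)
  show ?thesis unfolding convolution_def
    by (rule lin_map_comp[OF \<Delta>
      tensor_lift_linear[OF H H module_ground_space[OF K] bilin_map_functional_mult[OF K \<phi> \<psi>]]])
qed

text \<open>In Sweedler notation: \<open>c\<^sub>0 \<psi>(c\<^sub>1) \<phi>(c\<^sub>2) = c\<^sub>0 (\<psi> * \<phi>)(c\<^sub>1)\<close>.\<close>

lemma right_slice_right_slice:
  assumes C: "module K C" and H: "module K H"
    and \<rho>: "lin_map K C (tensor_space K C H) \<rho>" and \<Delta>: "lin_map K H (tensor_space K H H) \<Delta>"
    and \<phi>: "lin_map K H (ground_space K) \<phi>" and \<psi>: "lin_map K H (ground_space K) \<psi>"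
    and c: "c \<in> carrier C"
    and coassoc: "tensor_assoc K C H H (tensor_map K C H (tensor_space K C H) H \<rho> id (\<rho> c)) =
      tensor_map K C H C (tensor_space K H H) id \<Delta> (\<rho> c)"
  shows "right_slice K C H \<psi> (\<rho> (right_slice K C H \<phi> (\<rho> c))) =
    right_slice K C H (convolution K H \<Delta> \<psi> \<phi>) (\<rho> c)"
proof -
  have K: "cring K" using C by (rule module.axioms)
  interpret C: module K C by (rule C)
  \<comment> \<open>One trilinear map stands behind both sides: splitting the leg in
    \<open>H\<close> by \<open>\<Delta>\<close> produces the convolution, splitting the leg in
    \<open>C\<close> by \<open>\<rho>\<close> produces the iterated slice.\<close>
  let ?t = "\<lambda>u v w. (\<psi> v \<otimes>\<^bsub>K\<^esub> \<phi> w) \<odot>\<^bsub>C\<^esub> u"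
  have t1: "bilin_map K C H C (\<lambda>u v. ?t u v w)" if "w \<in> carrier H" for w
    by (rule bilin_map_flip[OF bilin_map_precomp[OF bilin_map_smult[OF C]
        functional_mult_right[OF K \<psi> functional_closed[OF \<phi> that]] lin_map_id]])
  have t2: "bilin_map K H H C (?t u)" if "u \<in> carrier C" for u
    by (rule bilin_map_comp[OF bilin_map_functional_mult[OF K \<psi> \<phi>] lin_map_smult_left[OF C that]])
  note \<rho>c = lin_map_closed[OF \<rho> c]
  note rs = right_slice_linear[OF C H] and rsp = right_slice_pure[OF C H]
  note \<chi> = convolution_linear[OF H \<Delta> \<psi> \<phi>]
  have "tensor_lift K C H C (\<lambda>u h. tensor_lift K H H C (?t u) (\<Delta> h)) (\<rho> c) =
      right_slice K C H (convolution K H \<Delta> \<psi> \<phi>) (\<rho> c)"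
  proof (rule tensor_lift_eqI[OF C H C bilin_map_precomp[OF trilin_lift_right[OF C H H C t1 t2] lin_map_id \<Delta>]
        rs[OF \<chi>] _ \<rho>c])
    fix u h assume u: "u \<in> carrier C" and h: "h \<in> carrier H"
    show "right_slice K C H (convolution K H \<Delta> \<psi> \<phi>) (pure_tensor K C H u h) = tensor_lift K H H C (?t u) (\<Delta> h)"
      unfolding rsp[OF \<chi> u h] convolution_def
      by (rule tensor_lift_comp[OF H H module_ground_space[OF K] bilin_map_functional_mult[OF K \<psi> \<phi>]
          C lin_map_smult_left[OF C u] lin_map_closed[OF \<Delta> h], symmetric])
  qed
  moreover have "tensor_lift K C H C (\<lambda>p w. tensor_lift K C H C (\<lambda>u v. ?t u v w) (\<rho> p)) (\<rho> c) =
      right_slice K C H \<psi> (\<rho> (right_slice K C H \<phi> (\<rho> c)))"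
  proof (rule tensor_lift_eqI[OF C H C bilin_map_precomp[OF trilin_lift_left[OF C H H C t1 t2] \<rho> lin_map_id]
        lin_map_comp[OF rs[OF \<phi>] lin_map_comp[OF \<rho> rs[OF \<psi>]]] _ \<rho>c])
    fix p w assume p: "p \<in> carrier C" and w: "w \<in> carrier H"
    note \<phi>w = functional_closed[OF \<phi> w]
    have "tensor_lift K C H C (\<lambda>u v. ?t u v w) (\<rho> p) = \<phi> w \<odot>\<^bsub>C\<^esub> right_slice K C H \<psi> (\<rho> p)"
      by (rule tensor_lift_eqI[OF C H C t1[OF w] lin_map_scale[OF C rs[OF \<psi>] \<phi>w] _ lin_map_closed[OF \<rho> p]])
        (simp add: rsp[OF \<psi>] functional_closed[OF \<psi>] \<phi>w C.smult_assoc1[symmetric] C.m_comm)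
    then show "right_slice K C H \<psi> (\<rho> (right_slice K C H \<phi> (pure_tensor K C H p w))) =
        tensor_lift K C H C (\<lambda>u v. ?t u v w) (\<rho> p)"
      by (simp add: rsp[OF \<phi> p w] lin_map_smult[OF \<rho> \<phi>w p] lin_map_smult[OF rs[OF \<psi>] \<phi>w lin_map_closed[OF \<rho> p]])
  qed
  ultimately show ?thesis
    using coassoc_tensor_lift[OF C H H C t1 t2 C H \<rho> \<Delta> \<rho>c \<rho>c coassoc] by simp
qed

context
  fixes K :: "('k, 'r) ring_scheme" and C :: "('k, 'c, 'm) module_scheme" and \<Delta> and c
    and \<phi> \<psi> :: "'c \<Rightarrow> 'k"
  assumes C: "module K C" and \<Delta>: "lin_map K C (tensor_space K C C) \<Delta>"
    and \<phi>: "lin_map K C (ground_space K) \<phi>" and \<psi>: "lin_map K C (ground_space K) \<psi>"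
    and c: "c \<in> carrier C"
    and coassoc: "tensor_assoc K C C C (tensor_map K C C (tensor_space K C C) C \<Delta> id (\<Delta> c)) =
      tensor_map K C C C (tensor_space K C C) id \<Delta> (\<Delta> c)"
begin

text \<open>Both sides are \<open>\<phi>(c\<^sub>1) \<psi>(c\<^sub>2) c\<^sub>3\<close>. The inner
  functional comes first in the convolution, opposite to the order for right slices.\<close>

lemma left_slice_left_slice:
  "left_slice K C C \<psi> (\<Delta> (left_slice K C C \<phi> (\<Delta> c))) = left_slice K C C (convolution K C \<Delta> \<phi> \<psi>) (\<Delta> c)"
proof -
  have K: "cring K" using C by (rule module.axioms)
  interpret C: module K C by (rule C)
  let ?t = "\<lambda>u v w. (\<phi> u \<otimes>\<^bsub>K\<^esub> \<psi> v) \<odot>\<^bsub>C\<^esub> w"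
  have t1: "bilin_map K C C C (\<lambda>u v. ?t u v w)" if "w \<in> carrier C" for w
    by (rule bilin_map_comp[OF bilin_map_functional_mult[OF K \<phi> \<psi>] lin_map_smult_left[OF C that]])
  have t2: "bilin_map K C C C (?t u)" if "u \<in> carrier C" for u
    by (rule bilin_map_precomp[OF bilin_map_smult[OF C]
        functional_mult_left[OF K \<psi> functional_closed[OF \<phi> that]] lin_map_id])
  note \<Delta>c = lin_map_closed[OF \<Delta> c]
  note ls = left_slice_linear[OF C C] and lsp = left_slice_pure[OF C C]
  note \<chi> = convolution_linear[OF C \<Delta> \<phi> \<psi>]
  have "tensor_lift K C C C (\<lambda>u q. tensor_lift K C C C (?t u) (\<Delta> q)) (\<Delta> c) =
      left_slice K C C \<psi> (\<Delta> (left_slice K C C \<phi> (\<Delta> c)))"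
  proof (rule tensor_lift_eqI[OF C C C bilin_map_precomp[OF trilin_lift_right[OF C C C C t1 t2] lin_map_id \<Delta>]
        lin_map_comp[OF ls[OF \<phi>] lin_map_comp[OF \<Delta> ls[OF \<psi>]]] _ \<Delta>c])
    fix u q assume u: "u \<in> carrier C" and q: "q \<in> carrier C"
    note \<phi>u = functional_closed[OF \<phi> u]
    have "tensor_lift K C C C (?t u) (\<Delta> q) = \<phi> u \<odot>\<^bsub>C\<^esub> left_slice K C C \<psi> (\<Delta> q)"
      by (rule tensor_lift_eqI[OF C C C t2[OF u] lin_map_scale[OF C ls[OF \<psi>] \<phi>u] _ lin_map_closed[OF \<Delta> q]])
        (simp add: lsp[OF \<psi>] functional_closed[OF \<psi>] \<phi>u C.smult_assoc1)
    then show "left_slice K C C \<psi> (\<Delta> (left_slice K C C \<phi> (pure_tensor K C C u q))) =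
        tensor_lift K C C C (?t u) (\<Delta> q)"
      by (simp add: lsp[OF \<phi> u q] lin_map_smult[OF \<Delta> \<phi>u q] lin_map_smult[OF ls[OF \<psi>] \<phi>u lin_map_closed[OF \<Delta> q]])
  qed
  moreover have "tensor_lift K C C C (\<lambda>p w. tensor_lift K C C C (\<lambda>u v. ?t u v w) (\<Delta> p)) (\<Delta> c) =
      left_slice K C C (convolution K C \<Delta> \<phi> \<psi>) (\<Delta> c)"
  proof (rule tensor_lift_eqI[OF C C C bilin_map_precomp[OF trilin_lift_left[OF C C C C t1 t2] \<Delta> lin_map_id]
        ls[OF \<chi>] _ \<Delta>c])
    fix p w assume p: "p \<in> carrier C" and w: "w \<in> carrier C"
    show "left_slice K C C (convolution K C \<Delta> \<phi> \<psi>) (pure_tensor K C C p w) =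
        tensor_lift K C C C (\<lambda>u v. ?t u v w) (\<Delta> p)"
      unfolding lsp[OF \<chi> p w] convolution_def
      by (rule tensor_lift_comp[OF C C module_ground_space[OF K] bilin_map_functional_mult[OF K \<phi> \<psi>]
          C lin_map_smult_left[OF C w] lin_map_closed[OF \<Delta> p], symmetric])
  qed
  ultimately show ?thesis
    using coassoc_tensor_lift[OF C C C C t1 t2 C C \<Delta> \<Delta> \<Delta>c \<Delta>c coassoc] by simp
qed

text \<open>Both sides are \<open>\<phi>(c\<^sub>1) c\<^sub>2 \<psi>(c\<^sub>3)\<close>: the two
  slices act on opposite ends of the iterated comultiplication.\<close>

lemma right_slice_left_slice:
  "right_slice K C C \<psi> (\<Delta> (left_slice K C C \<phi> (\<Delta> c))) = left_slice K C C \<phi> (\<Delta> (right_slice K C C \<psi> (\<Delta> c)))"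
proof -
  have K: "cring K" using C by (rule module.axioms)
  interpret C: module K C by (rule C)
  let ?t = "\<lambda>u v w. (\<phi> u \<otimes>\<^bsub>K\<^esub> \<psi> w) \<odot>\<^bsub>C\<^esub> v"
  have t1: "bilin_map K C C C (\<lambda>u v. ?t u v w)" if "w \<in> carrier C" for w
    by (rule bilin_map_precomp[OF bilin_map_smult[OF C]
        functional_mult_right[OF K \<phi> functional_closed[OF \<psi> that]] lin_map_id])
  have t2: "bilin_map K C C C (?t u)" if "u \<in> carrier C" for u
    by (rule bilin_map_flip[OF bilin_map_precomp[OF bilin_map_smult[OF C]
        functional_mult_left[OF K \<psi> functional_closed[OF \<phi> that]] lin_map_id]])
  note \<Delta>c = lin_map_closed[OF \<Delta> c]
  note ls = left_slice_linear[OF C C] and lsp = left_slice_pure[OF C C]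
  note rs = right_slice_linear[OF C C] and rsp = right_slice_pure[OF C C]
  have "tensor_lift K C C C (\<lambda>u q. tensor_lift K C C C (?t u) (\<Delta> q)) (\<Delta> c) =
      right_slice K C C \<psi> (\<Delta> (left_slice K C C \<phi> (\<Delta> c)))"
  proof (rule tensor_lift_eqI[OF C C C bilin_map_precomp[OF trilin_lift_right[OF C C C C t1 t2] lin_map_id \<Delta>]
        lin_map_comp[OF ls[OF \<phi>] lin_map_comp[OF \<Delta> rs[OF \<psi>]]] _ \<Delta>c])
    fix u q assume u: "u \<in> carrier C" and q: "q \<in> carrier C"
    note \<phi>u = functional_closed[OF \<phi> u]
    have "tensor_lift K C C C (?t u) (\<Delta> q) = \<phi> u \<odot>\<^bsub>C\<^esub> right_slice K C C \<psi> (\<Delta> q)"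
      by (rule tensor_lift_eqI[OF C C C t2[OF u] lin_map_scale[OF C rs[OF \<psi>] \<phi>u] _ lin_map_closed[OF \<Delta> q]])
        (simp add: rsp[OF \<psi>] functional_closed[OF \<psi>] \<phi>u C.smult_assoc1)
    then show "right_slice K C C \<psi> (\<Delta> (left_slice K C C \<phi> (pure_tensor K C C u q))) =
        tensor_lift K C C C (?t u) (\<Delta> q)"
      by (simp add: lsp[OF \<phi> u q] lin_map_smult[OF \<Delta> \<phi>u q] lin_map_smult[OF rs[OF \<psi>] \<phi>u lin_map_closed[OF \<Delta> q]])
  qed
  moreover have "tensor_lift K C C C (\<lambda>p w. tensor_lift K C C C (\<lambda>u v. ?t u v w) (\<Delta> p)) (\<Delta> c) =
      left_slice K C C \<phi> (\<Delta> (right_slice K C C \<psi> (\<Delta> c)))"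
  proof (rule tensor_lift_eqI[OF C C C bilin_map_precomp[OF trilin_lift_left[OF C C C C t1 t2] \<Delta> lin_map_id]
        lin_map_comp[OF rs[OF \<psi>] lin_map_comp[OF \<Delta> ls[OF \<phi>]]] _ \<Delta>c])
    fix p w assume p: "p \<in> carrier C" and w: "w \<in> carrier C"
    note \<psi>w = functional_closed[OF \<psi> w]
    have "tensor_lift K C C C (\<lambda>u v. ?t u v w) (\<Delta> p) = \<psi> w \<odot>\<^bsub>C\<^esub> left_slice K C C \<phi> (\<Delta> p)"
      by (rule tensor_lift_eqI[OF C C C t1[OF w] lin_map_scale[OF C ls[OF \<phi>] \<psi>w] _ lin_map_closed[OF \<Delta> p]])
        (simp add: lsp[OF \<phi>] functional_closed[OF \<phi>] \<psi>w C.smult_assoc1[symmetric] C.m_comm)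
    then show "left_slice K C C \<phi> (\<Delta> (right_slice K C C \<psi> (pure_tensor K C C p w))) =
        tensor_lift K C C C (\<lambda>u v. ?t u v w) (\<Delta> p)"
      by (simp add: rsp[OF \<psi> p w] lin_map_smult[OF \<Delta> \<psi>w p] lin_map_smult[OF ls[OF \<phi>] \<psi>w lin_map_closed[OF \<Delta> p]])
  qed
  ultimately show ?thesis
    using coassoc_tensor_lift[OF C C C C t1 t2 C C \<Delta> \<Delta> \<Delta>c \<Delta>c coassoc] by simp
qed

end

section \<open>The diagonal coaction\<close>

context
  fixes K :: "('k, 'r) ring_scheme" and H :: "('k, 'h, 'l) module_scheme"
    and C :: "('k, 'c, 'm) module_scheme" and \<rho>
  assumes H: "module K H" and C: "module K C" and mult: "bilin_map K H H H (mult H)"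
    and \<rho>: "lin_map K C (tensor_space K C H) \<rho>"
begin

private abbreviation (input) "CH \<equiv> tensor_space K C H"
private abbreviation (input) "T \<equiv> tensor_space K (tensor_space K C C) H"
private abbreviation (input) "q v\<^sub>0 v\<^sub>1 w\<^sub>0 w\<^sub>1 \<equiv>
  pure_tensor K (tensor_space K C C) H (pure_tensor K C C v\<^sub>0 w\<^sub>0) (v\<^sub>1 \<otimes>\<^bsub>H\<^esub> w\<^sub>1)"

private lemma T: "module K T"
  by (rule module_tensor_space[OF module_tensor_space[OF C C] H])

private lemma bilin_q:
  "\<lbrakk>v\<^sub>0 \<in> carrier C; v\<^sub>1 \<in> carrier H\<rbrakk> \<Longrightarrow> bilin_map K C H T (\<lambda>w\<^sub>0 w\<^sub>1. q v\<^sub>0 v\<^sub>1 w\<^sub>0 w\<^sub>1)"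
  by (rule bilin_map_precomp[OF bilin_map_pure_tensor[OF module_tensor_space[OF C C] H]
        bilin_map_right[OF bilin_map_pure_tensor[OF C C]] bilin_map_right[OF mult]])

text \<open>The tensor \<open>Y\<close> stands for the coaction of the second factor. Keeping it
  arbitrary allows linearity in it to be used in \<open>bilin_tensor_coaction\<close>.\<close>

private lemma bilin_lift_q:
  assumes Y: "Y \<in> carrier CH"
  shows "bilin_map K C H T (\<lambda>v\<^sub>0 v\<^sub>1. tensor_lift K C H T (\<lambda>w\<^sub>0 w\<^sub>1. q v\<^sub>0 v\<^sub>1 w\<^sub>0 w\<^sub>1) Y)"
proof (rule bilin_mapI)
  note pureT = bilin_map_pure_tensor[OF module_tensor_space[OF C C] H]
  note pureC = bilin_map_pure_tensor[OF C C]
  show "lin_map K C T (\<lambda>v\<^sub>0. tensor_lift K C H T (\<lambda>w\<^sub>0 w\<^sub>1. q v\<^sub>0 v\<^sub>1 w\<^sub>0 w\<^sub>1) Y)" if v1: "v\<^sub>1 \<in> carrier H" for v\<^sub>1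
    by (rule bilin_map_left[OF bilin_map_tensor_lift[OF C H T C bilin_q[OF _ v1]
            lin_map_comp[OF bilin_map_left[OF pureC] bilin_map_left[OF pureT bilin_map_closed[OF mult v1]]]] Y])
  show "lin_map K H T (\<lambda>v\<^sub>1. tensor_lift K C H T (\<lambda>w\<^sub>0 w\<^sub>1. q v\<^sub>0 v\<^sub>1 w\<^sub>0 w\<^sub>1) Y)" if v0: "v\<^sub>0 \<in> carrier C" for v\<^sub>0
    by (rule bilin_map_left[OF bilin_map_tensor_lift[OF C H T H bilin_q[OF v0]
            lin_map_comp[OF bilin_map_left[OF mult] bilin_map_right[OF pureT pure_tensor_closed[OF C C v0]]]] Y])
qed

text \<open>The nested lift is bilinear in two independent tensors of C \<otimes> H; precomposing
  with \<open>\<rho>\<close> in both places gives the claim.\<close>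

lemma bilin_tensor_coaction:
  "bilin_map K C C T (\<lambda>v w. tensor_lift K C H T
    (\<lambda>v\<^sub>0 v\<^sub>1. tensor_lift K C H T (\<lambda>w\<^sub>0 w\<^sub>1. q v\<^sub>0 v\<^sub>1 w\<^sub>0 w\<^sub>1) (\<rho> w)) (\<rho> v))"
  by (rule bilin_map_flip[OF bilin_map_precomp[OF bilin_map_tensor_lift[OF C H T module_tensor_space[OF C H]
          bilin_lift_q tensor_lift_linear[OF C H T bilin_q]] \<rho> \<rho>]])

lemma tensor_coaction_linear:
  "lin_map K (tensor_space K C C) T (tensor_coaction K H C \<rho> C \<rho>)"
  unfolding tensor_coaction_def Let_def by (rule tensor_lift_linear[OF C C T bilin_tensor_coaction])

lemma tensor_coaction_pure:
  "\<lbrakk>v \<in> carrier C; w \<in> carrier C\<rbrakk> \<Longrightarrow> tensor_coaction K H C \<rho> C \<rho> (pure_tensor K C C v w) =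
    tensor_lift K C H T (\<lambda>v\<^sub>0 v\<^sub>1. tensor_lift K C H T (\<lambda>w\<^sub>0 w\<^sub>1. q v\<^sub>0 v\<^sub>1 w\<^sub>0 w\<^sub>1) (\<rho> w)) (\<rho> v)"
  unfolding tensor_coaction_def Let_def by (rule tensor_lift_pure[OF C C T bilin_tensor_coaction])

text \<open>By linearity the two coactions may be replaced by pure tensors a \<otimes> h and a'
  \<otimes> h' with \<open>a\<close> and \<open>a'\<close> in \<open>D\<close>. The slice is then
  the multiple of a \<otimes> a' by the scalar that \<theta> assigns to the product of
  \<open>h\<close> and \<open>h'\<close>.\<close>

lemma right_slice_tensor_coaction:
  assumes D: "D \<subseteq> carrier C" and \<theta>: "lin_map K H (ground_space K) \<theta>"
    and v: "v \<in> carrier C" "\<rho> v \<in> tensor_subspace K C H D (carrier H)"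
    and w: "w \<in> carrier C" "\<rho> w \<in> tensor_subspace K C H D (carrier H)"
  shows "right_slice K (tensor_space K C C) H \<theta> (tensor_coaction K H C \<rho> C \<rho> (pure_tensor K C C v w))
    \<in> tensor_subspace K C C D D"
proof -
  note CC = module_tensor_space[OF C C]
  note N = tensor_subspace_submodule[OF C C D D]
  note rs = right_slice_linear[OF CC H \<theta>]
  note wc = lin_map_closed[OF \<rho> w(1)]
  show ?thesis unfolding tensor_coaction_pure[OF v(1) w(1)]
  proof (rule tensor_subspace_map[OF C H CC lin_map_comp[OF tensor_lift_linear[OF C H T bilin_lift_q[OF wc]] rs]
        N D order.refl _ v(2)])
    fix a h assume a: "a \<in> D" and h: "h \<in> carrier H"
    have ac: "a \<in> carrier C" using a D by blast
    show "right_slice K (tensor_space K C C) H \<theta> (tensor_lift K C H T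
        (\<lambda>v\<^sub>0 v\<^sub>1. tensor_lift K C H T (\<lambda>w\<^sub>0 w\<^sub>1. q v\<^sub>0 v\<^sub>1 w\<^sub>0 w\<^sub>1) (\<rho> w)) (pure_tensor K C H a h))
      \<in> tensor_subspace K C C D D"
      unfolding tensor_lift_pure[OF C H T bilin_lift_q[OF wc] ac h]
    proof (rule tensor_subspace_map[OF C H CC lin_map_comp[OF tensor_lift_linear[OF C H T bilin_q[OF ac h]] rs]
          N D order.refl _ w(2)])
      fix a' h' assume a': "a' \<in> D" and h': "h' \<in> carrier H"
      have ac': "a' \<in> carrier C" using a' D by blast
      note hh = bilin_map_closed[OF mult h h']
      show "right_slice K (tensor_space K C C) H \<theta> (tensor_lift K C H T (\<lambda>w\<^sub>0 w\<^sub>1. q a h w\<^sub>0 w\<^sub>1) (pure_tensor K C H a' h'))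
        \<in> tensor_subspace K C C D D"
        unfolding tensor_lift_pure[OF C H T bilin_q[OF ac h] ac' h']
          right_slice_pure[OF CC H \<theta> pure_tensor_closed[OF C C ac ac'] hh]
        by (rule submodule_smult[OF CC N functional_closed[OF \<theta> hh] tensor_subspace_intro[OF C C a a']])
    qed
  qed
qed

end

section \<open>Finite-dimensional subcomodule subcoalgebras\<close>

lemma (in assoc_algebra) bilin_mult: "bilin_map K A A A (mult A)"
  by (intro bilin_mapI lin_mapI)
    (simp_all add: smult_mult_left smult_mult_right l_distr r_distr)

theorem theorem4p5:
  fixes K :: "('k, 'r) ring_scheme"
    and H :: "('k, 'h, 'l) module_scheme"
    and C :: "('k, 'c, 'm) module_scheme"
  assumes "field K"
    and "bialgebra K H \<Delta>\<^sub>H \<epsilon>\<^sub>H"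
    and "comodule_coalgebra K H \<Delta>\<^sub>H \<epsilon>\<^sub>H C \<Delta> \<epsilon> \<rho>"
    and "finite F" and "F \<subseteq> carrier C"
  shows "\<exists>D. F \<subseteq> D \<and> finite_dim_subspace K C D \<and> subcomodule K H C \<rho> D \<and> subcoalgebra K C \<Delta> D"
proof -
  note K = \<open>field K\<close>
  have comod: "right_comodule K H \<Delta>\<^sub>H \<epsilon>\<^sub>H C \<rho>" and coalgC: "coalgebra K C \<Delta> \<epsilon>"
    using assms(3) unfolding comodule_coalgebra_def by blast+
  have coalgH: "coalgebra K H \<Delta>\<^sub>H \<epsilon>\<^sub>H" and algH: "assoc_algebra K H"
    using assms(2) unfolding bialgebra_def by blast+
  have C: "module K C" and H: "module K H"
    using coalgC coalgH unfolding coalgebra_def by blast+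
  note \<Delta> = coalgebra.comult_linear[OF coalgC] and \<epsilon> = coalgebra.counit_linear[OF coalgC]
  note \<Delta>H = coalgebra.comult_linear[OF coalgH] and \<epsilon>H = coalgebra.counit_linear[OF coalgH]
  note \<rho> = right_comodule.coact_linear[OF comod]
  note mult = assoc_algebra.bilin_mult[OF algH]
  note CC = module_tensor_space[OF C C]
  have colinear: "\<rho>\<^sub>C\<^sub>C (\<Delta> c) = tensor_map K C H (tensor_space K C C) H \<Delta> id (\<rho> c)"
    if "c \<in> carrier C" "\<rho>\<^sub>C\<^sub>C = tensor_coaction K H C \<rho> C \<rho>" for c \<rho>\<^sub>C\<^sub>C
    using comodule_coalgebra.comult_comodule_map[OF assms(3)] that unfolding comodule_map_def by simp
  let ?L = "left_slice K C C" and ?R = "right_slice K C C" and ?P = "right_slice K C H"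
  interpret L: slicing K C C "tensor_space K C C" "pure_tensor K C C" ?L
    by (rule slicing_left[OF C C K])
  interpret R: slicing K C C "tensor_space K C C" "\<lambda>w v. pure_tensor K C C v w" ?R
    by (rule slicing_right[OF C C K])
  interpret P: slicing K H C "tensor_space K C H" "\<lambda>w v. pure_tensor K C H v w" ?P
    by (rule slicing_right[OF C H K])
  \<comment> \<open>Slicing by the counit returns the element. This yields the inclusion of each
    space in its hull.\<close>
  have counits: "?L \<epsilon> (\<Delta> c) = c" "?R \<epsilon> (\<Delta> c) = c" "?P \<epsilon>\<^sub>H (\<rho> c) = c" if "c \<in> carrier C" for c
    unfolding left_slice_def right_slice_def
    using coalgebra.counit_left[OF coalgC that] coalgebra.counit_right[OF coalgC that]
      right_comodule.coact_counit[OF comod that] by simp_all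
  note coassoc = coalgebra.coassoc[OF coalgC]

  define E\<^sub>0 where "E\<^sub>0 = lin_span K C F"
  define E where "E = R.hull \<Delta> E\<^sub>0"
  define D\<^sub>0 where "D\<^sub>0 = L.hull \<Delta> E"
  define D where "D = P.hull \<rho> D\<^sub>0"
  have fd0: "finite_dim_subspace K C E\<^sub>0"
    unfolding finite_dim_subspace_def E\<^sub>0_def using assms(4,5) lin_span_submodule[OF C assms(5)] by blast
  have fdE: "finite_dim_subspace K C E" unfolding E_def by (rule R.hull_finite_dim[OF \<Delta> fd0])
  have fdD0: "finite_dim_subspace K C D\<^sub>0" unfolding D\<^sub>0_def by (rule L.hull_finite_dim[OF \<Delta> fdE])
  have fdD: "finite_dim_subspace K C D" unfolding D_def by (rule P.hull_finite_dim[OF \<rho> fdD0])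
  have sub: "submodule N K C" "N \<subseteq> carrier C" if "finite_dim_subspace K C N" for N
    using that submodule_carrier[OF C] unfolding finite_dim_subspace_def by blast+

  have "F \<subseteq> E\<^sub>0" unfolding E\<^sub>0_def by (rule lin_span_superset)
  moreover have "E\<^sub>0 \<subseteq> E"
  proof
    fix c assume c: "c \<in> E\<^sub>0"
    show "c \<in> E" using R.hull_intro[OF \<Delta> \<epsilon> c] counits(2)[OF subsetD[OF sub(2)[OF fd0] c]] by (simp add: E_def)
  qed
  moreover have "E \<subseteq> D\<^sub>0"
  proof
    fix c assume c: "c \<in> E"
    show "c \<in> D\<^sub>0" using L.hull_intro[OF \<Delta> \<epsilon> c] counits(1)[OF subsetD[OF sub(2)[OF fdE] c]] by (simp add: D\<^sub>0_def)
  qed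
  moreover have D0D: "D\<^sub>0 \<subseteq> D"
  proof
    fix c assume c: "c \<in> D\<^sub>0"
    show "c \<in> D" using P.hull_intro[OF \<rho> \<epsilon>H c] counits(3)[OF subsetD[OF sub(2)[OF fdD0] c]] by (simp add: D_def)
  qed
  ultimately have FD: "F \<subseteq> D" by blast

  \<comment> \<open>The composition law for comodules is applied to \<open>C\<close> coacting on
    itself by \<open>\<Delta>\<close>: a further right slice of a generator is again a generator,
    with a convolution as functional.\<close>
  have RE: "?R \<psi> (\<Delta> x) \<in> E" if \<psi>: "lin_map K C (ground_space K) \<psi>" and x: "x \<in> E" for \<psi> x
  proof (rule R.hull_map[OF \<Delta> C lin_map_comp[OF \<Delta> right_slice_linear[OF C C \<psi>]] sub(1)[OF fdE]
        sub(2)[OF fd0] _ x[unfolded E_def]])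
    fix \<phi> y assume \<phi>: "lin_map K C (ground_space K) \<phi>" and y: "y \<in> E\<^sub>0"
    note yc = subsetD[OF sub(2)[OF fd0] y]
    show "?R \<psi> (\<Delta> (?R \<phi> (\<Delta> y))) \<in> E"
      unfolding right_slice_right_slice[OF C C \<Delta> \<Delta> \<phi> \<psi> yc coassoc[OF yc]] E_def
      by (rule R.hull_intro[OF \<Delta> convolution_linear[OF C \<Delta> \<psi> \<phi>] y])
  qed
  \<comment> \<open>A right slice moves past the left slice that formed the generator and acts
    inside \<open>E\<close>, which is already stable under it.\<close>
  have RD0: "?R \<psi> (\<Delta> x) \<in> D\<^sub>0" if \<psi>: "lin_map K C (ground_space K) \<psi>" and x: "x \<in> D\<^sub>0" for \<psi> x
  proof (rule L.hull_map[OF \<Delta> C lin_map_comp[OF \<Delta> right_slice_linear[OF C C \<psi>]] sub(1)[OF fdD0]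
        sub(2)[OF fdE] _ x[unfolded D\<^sub>0_def]])
    fix \<phi> y assume \<phi>: "lin_map K C (ground_space K) \<phi>" and y: "y \<in> E"
    note yc = subsetD[OF sub(2)[OF fdE] y]
    show "?R \<psi> (\<Delta> (?L \<phi> (\<Delta> y))) \<in> D\<^sub>0"
      unfolding right_slice_left_slice[OF C \<Delta> \<phi> \<psi> yc coassoc[OF yc]] D\<^sub>0_def
      by (rule L.hull_intro[OF \<Delta> \<phi> RE[OF \<psi> y]])
  qed
  have LD0: "?L \<psi> (\<Delta> x) \<in> D\<^sub>0" if \<psi>: "lin_map K C (ground_space K) \<psi>" and x: "x \<in> D\<^sub>0" for \<psi> x
  proof (rule L.hull_map[OF \<Delta> C lin_map_comp[OF \<Delta> left_slice_linear[OF C C \<psi>]] sub(1)[OF fdD0]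
        sub(2)[OF fdE] _ x[unfolded D\<^sub>0_def]])
    fix \<phi> y assume \<phi>: "lin_map K C (ground_space K) \<phi>" and y: "y \<in> E"
    note yc = subsetD[OF sub(2)[OF fdE] y]
    show "?L \<psi> (\<Delta> (?L \<phi> (\<Delta> y))) \<in> D\<^sub>0"
      unfolding left_slice_left_slice[OF C \<Delta> \<phi> \<psi> yc coassoc[OF yc]] D\<^sub>0_def
      by (rule L.hull_intro[OF \<Delta> convolution_linear[OF C \<Delta> \<phi> \<psi>] y])
  qed
  \<comment> \<open>Stability under right slices confines the first leg to \<open>D\<^sub>0\<close>,
    and stability under left slices then confines the second.\<close>
  have \<Delta>D0: "\<Delta> x \<in> tensor_subspace K C C D\<^sub>0 D\<^sub>0" if x: "x \<in> D\<^sub>0" for x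
    by (rule tensor_subspace_if_left_slices[OF C C K sub(1)[OF fdD0] sub(1)[OF fdD0]
        tensor_subspace_if_right_slices[OF C C K sub(1)[OF fdD0]
          lin_map_closed[OF \<Delta> subsetD[OF sub(2)[OF fdD0] x]] RD0[OF _ x]] LD0[OF _ x]])

  have PD: "?P \<psi> (\<rho> x) \<in> D" if \<psi>: "lin_map K H (ground_space K) \<psi>" and x: "x \<in> D" for \<psi> x
  proof (rule P.hull_map[OF \<rho> C lin_map_comp[OF \<rho> right_slice_linear[OF C H \<psi>]] sub(1)[OF fdD]
        sub(2)[OF fdD0] _ x[unfolded D_def]])
    fix \<phi> y assume \<phi>: "lin_map K H (ground_space K) \<phi>" and y: "y \<in> D\<^sub>0"
    note yc = subsetD[OF sub(2)[OF fdD0] y]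
    show "?P \<psi> (\<rho> (?P \<phi> (\<rho> y))) \<in> D"
      unfolding right_slice_right_slice[OF C H \<rho> \<Delta>H \<phi> \<psi> yc right_comodule.coact_coassoc[OF comod yc]] D_def
      by (rule P.hull_intro[OF \<rho> convolution_linear[OF H \<Delta>H \<psi> \<phi>] y])
  qed
  \<comment> \<open>Only the leg in \<open>C\<close> has to be confined, so right slices alone
    decide.\<close>
  have \<rho>D: "\<rho> x \<in> tensor_subspace K C H D (carrier H)" if x: "x \<in> D" for x
    by (rule tensor_subspace_if_right_slices[OF C H K sub(1)[OF fdD]
        lin_map_closed[OF \<rho> subsetD[OF sub(2)[OF fdD] x]] PD[OF _ x]])

  \<comment> \<open>Colinearity of \<open>\<Delta>\<close> turns \<open>\<Delta>(d\<^sub>0 \<theta>(d\<^sub>1))\<close> into a slice of the diagonal coaction of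
    \<open>\<Delta>(d) \<in> D\<^sub>0 \<otimes> D\<^sub>0\<close>, and \<open>D \<otimes> D\<close> is stable under such slices.\<close>
  have \<Delta>D: "\<Delta> x \<in> tensor_subspace K C C D D" if x: "x \<in> D" for x
  proof (rule P.hull_map[OF \<rho> CC \<Delta> tensor_subspace_submodule[OF C C sub(2)[OF fdD] sub(2)[OF fdD]]
        sub(2)[OF fdD0] _ x[unfolded D_def]])
    fix \<theta> y assume \<theta>: "lin_map K H (ground_space K) \<theta>" and y: "y \<in> D\<^sub>0"
    note yc = subsetD[OF sub(2)[OF fdD0] y]
    note rsCC = right_slice_linear[OF CC H \<theta>]
    \<comment> \<open>Slicing the leg in \<open>H\<close> commutes with \<open>\<Delta>\<close> on
      the leg in \<open>C\<close>. The identity is stated for arbitrary \<open>X\<close> because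
      \<open>\<rho> y\<close> need not be pure, while linearity in \<open>X\<close> reduces it to
      pure tensors.\<close>
    have "\<Delta> (?P \<theta> X) = right_slice K (tensor_space K C C) H \<theta> (tensor_map K C H (tensor_space K C C) H \<Delta> id X)"
      if "X \<in> carrier (tensor_space K C H)" for X
    proof (rule tensor_lin_map_eqI[OF C H CC lin_map_comp[OF right_slice_linear[OF C H \<theta>] \<Delta>]
          lin_map_comp[OF tensor_map_linear[OF C H CC H \<Delta> lin_map_id'] rsCC] _ that])
      fix v w assume v: "v \<in> carrier C" and w: "w \<in> carrier H"
      show "\<Delta> (?P \<theta> (pure_tensor K C H v w)) = right_slice K (tensor_space K C C) H \<theta>
          (tensor_map K C H (tensor_space K C C) H \<Delta> id (pure_tensor K C H v w))"
        by (simp add: right_slice_pure[OF C H \<theta> v w] tensor_map_pure[OF C H CC H \<Delta> lin_map_id' v w]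
            right_slice_pure[OF CC H \<theta> lin_map_closed[OF \<Delta> v] w] lin_map_smult[OF \<Delta> functional_closed[OF \<theta> w] v])
    qed
    then have "\<Delta> (?P \<theta> (\<rho> y)) =
        right_slice K (tensor_space K C C) H \<theta> (tensor_coaction K H C \<rho> C \<rho> (\<Delta> y))"
      using lin_map_closed[OF \<rho> yc] colinear[OF yc refl] by simp
    also have "\<dots> \<in> tensor_subspace K C C D D"
    proof (rule tensor_subspace_map[OF C C CC lin_map_comp[OF tensor_coaction_linear[OF H C mult \<rho>] rsCC]
          tensor_subspace_submodule[OF C C sub(2)[OF fdD] sub(2)[OF fdD]] sub(2)[OF fdD0] sub(2)[OF fdD0] _ \<Delta>D0[OF y]])
      fix a b assume a: "a \<in> D\<^sub>0" and b: "b \<in> D\<^sub>0"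
      show "right_slice K (tensor_space K C C) H \<theta> (tensor_coaction K H C \<rho> C \<rho> (pure_tensor K C C a b))
        \<in> tensor_subspace K C C D D"
        by (rule right_slice_tensor_coaction[OF H C mult \<rho> sub(2)[OF fdD] \<theta>
            subsetD[OF sub(2)[OF fdD0] a] \<rho>D[OF subsetD[OF D0D a]]
            subsetD[OF sub(2)[OF fdD0] b] \<rho>D[OF subsetD[OF D0D b]]])
    qed
    finally show "\<Delta> (?P \<theta> (\<rho> y)) \<in> tensor_subspace K C C D D" .
  qed
  show ?thesis
    using FD fdD sub(1)[OF fdD] \<rho>D \<Delta>D unfolding subcomodule_def subcoalgebra_def by blast
qed

end
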